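(* There is an $\omega$-model of $\mathsf{RCA}_0 + F\mathsf{IP}$ consisting entirely of low sets. Therefore $F\mathsf{IP}$ does not imply $\mathsf{ACA}_0$ over $\mathsf{RCA}_0$.
   Context: $\mathsf{RCA}_0$ is the subsystem of second-order arithmetic (language $\mathsf{L}_2$) consisting of the axioms of a discrete ordered semiring, $\Sigma^0_1$ induction and $\Delta^0_1$ comprehension; $\mathsf{ACA}_0$ adds comprehension for arithmetical formulas. An $\omega$-model is an $\mathsf{L}_2$-structure whose numbers are the standard natural numbers $\omega$ with the standard interpretation of the symbols; it is identified with the collection of subsets of $\omega$ it contains. A set $X$ is low if $X' \leq_T \emptyset'$. A family of sets is a sequence $A = \langle A_i : i \in \mathbb{N}\rangle$ of sets of natural numbers (coded as a single set); it is nontrivial if $A_i \neq \emptyset$ for some $i$. A family $B = \langle B_i : i\in\mathbb{N}\rangle$ is a subfamily of $A$ if $(\forall i)(\exists j)[B_i = A_j]$. Two members of a family are distinct if they differ extensionally as sets. A family has the $F$ intersection property if for every $m \geq 2$, the intersection of any $m$ distinct sets in it is nonempty. $B$ is a maximal subfamily of $A$ with the $F$ intersection property if $B$ is a subfamily of $A$ with the $F$ intersection property, and for every subfamily $C$ of $A$ that also has this property, if $B$ is a subfamily of $C$ then $C$ is a subfamily of $B$. $F\mathsf{IP}$ is the statement: every nontrivial family of sets has a maximal subfamily with the $F$ intersection property. *)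

theory Defs
  imports "HOL-Library.Nat_Bijection" "HOL-Number_Theory.Cong"
begin

section \<open>The language of second-order arithmetic and its structures\<close>

datatype tm =
    Var nat
  | Zero
  | One
  | Plus tm tm  (infixl "\<^bold>+" 75)
  | Times tm tm  (infixl "\<^bold>*" 80)

text \<open>Number variables and set variables are two separate copies of \<^typ>\<open>nat\<close>; in
  \<open>Mem t X\<close> the second argument is a set variable.\<close>

datatype form =
    Eq tm tm  (infix "\<^bold>=" 70)
  | Less tm tm  (infix "\<^bold><" 70)
  | Mem tm nat  (infix "\<^bold>\<in>" 70)
  | Neg form  ("\<^bold>\<not> _" [68] 68)
  | Conj form form  (infixr "\<^bold>\<and>" 65)
  | Disj form form  (infixr "\<^bold>\<or>" 60)
  | Imp form form  (infixr "\<^bold>\<longrightarrow>" 55)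
  | Iff form form  (infixr "\<^bold>\<longleftrightarrow>" 55)
  | AllN nat form
  | ExN nat form
  | AllS nat form
  | ExS nat form

text \<open>The first-order part of a structure is the whole of \<^typ>\<open>'a\<close>; the second-order part is
  a collection of subsets of it.\<close>

record 'a L2_structure =
  szero :: 'a
  sone :: 'a
  splus :: "'a \<Rightarrow> 'a \<Rightarrow> 'a"
  stimes :: "'a \<Rightarrow> 'a \<Rightarrow> 'a"
  sless :: "'a \<Rightarrow> 'a \<Rightarrow> bool"
  ssets :: "'a set set"

fun tm_val :: "'a L2_structure \<Rightarrow> (nat \<Rightarrow> 'a) \<Rightarrow> tm \<Rightarrow> 'a" where
  "tm_val M e (Var x) = e x"
| "tm_val M e Zero = szero M"
| "tm_val M e One = sone M"
| "tm_val M e (s \<^bold>+ t) = splus M (tm_val M e s) (tm_val M e t)"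
| "tm_val M e (s \<^bold>* t) = stimes M (tm_val M e s) (tm_val M e t)"

fun sat :: "'a L2_structure \<Rightarrow> (nat \<Rightarrow> 'a) \<Rightarrow> (nat \<Rightarrow> 'a set) \<Rightarrow> form \<Rightarrow> bool" where
  "sat M e E (s \<^bold>= t) \<longleftrightarrow> tm_val M e s = tm_val M e t"
| "sat M e E (s \<^bold>< t) \<longleftrightarrow> sless M (tm_val M e s) (tm_val M e t)"
| "sat M e E (t \<^bold>\<in> X) \<longleftrightarrow> tm_val M e t \<in> E X"
| "sat M e E (\<^bold>\<not> \<phi>) \<longleftrightarrow> \<not> sat M e E \<phi>"
| "sat M e E (\<phi> \<^bold>\<and> \<psi>) \<longleftrightarrow> sat M e E \<phi> \<and> sat M e E \<psi>"
| "sat M e E (\<phi> \<^bold>\<or> \<psi>) \<longleftrightarrow> sat M e E \<phi> \<or> sat M e E \<psi>"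
| "sat M e E (\<phi> \<^bold>\<longrightarrow> \<psi>) \<longleftrightarrow> (sat M e E \<phi> \<longrightarrow> sat M e E \<psi>)"
| "sat M e E (\<phi> \<^bold>\<longleftrightarrow> \<psi>) \<longleftrightarrow> (sat M e E \<phi> \<longleftrightarrow> sat M e E \<psi>)"
| "sat M e E (AllN x \<phi>) \<longleftrightarrow> (\<forall>a. sat M (e(x := a)) E \<phi>)"
| "sat M e E (ExN x \<phi>) \<longleftrightarrow> (\<exists>a. sat M (e(x := a)) E \<phi>)"
| "sat M e E (AllS X \<phi>) \<longleftrightarrow> (\<forall>A \<in> ssets M. sat M e (E(X := A)) \<phi>)"
| "sat M e E (ExS X \<phi>) \<longleftrightarrow> (\<exists>A \<in> ssets M. sat M e (E(X := A)) \<phi>)"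

text \<open>A formula holds in \<open>M\<close> if its universal closure does. As usual in first-order logic, both
  sorts of a structure are nonempty; without this requirement on the second sort every formula
  would hold vacuously in a structure without sets.\<close>

definition models :: "'a L2_structure \<Rightarrow> form set \<Rightarrow> bool"  (infix "\<Turnstile>" 50) where
  "M \<Turnstile> T \<longleftrightarrow> ssets M \<noteq> {} \<and>
     (\<forall>\<phi>\<in>T. \<forall>e E. (\<forall>X. E X \<in> ssets M) \<longrightarrow> sat M e E \<phi>)"

text \<open>\<open>implies_over T \<Phi> \<Psi>\<close>: over \<open>T\<close>, the theory \<open>\<Phi>\<close> implies the theory \<open>\<Psi>\<close>. The language is
  countable, and the theories considered here have only infinite models, so by the downward
  Loewenheim-Skolem theorem it suffices to let the numbers of the structures range over one
  countably infinite type (whose own arithmetic plays no role).\<close>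

definition implies_over :: "form set \<Rightarrow> form set \<Rightarrow> form set \<Rightarrow> bool" where
  "implies_over T \<Phi> \<Psi> \<longleftrightarrow> (\<forall>M :: nat L2_structure. M \<Turnstile> T \<union> \<Phi> \<longrightarrow> M \<Turnstile> \<Psi>)"

definition omega :: "nat set set \<Rightarrow> nat L2_structure" where
  "omega S = \<lparr>szero = 0, sone = 1, splus = (+), stimes = (*), sless = (<), ssets = S\<rparr>"

lemma omega_simps [simp]:
  "szero (omega S) = 0" "sone (omega S) = 1" "splus (omega S) = (+)"
  "stimes (omega S) = (*)" "sless (omega S) = (<)" "ssets (omega S) = S"
  by (simp_all add: omega_def)


section \<open>The systems \<open>RCA\<^sub>0\<close> and \<open>ACA\<^sub>0\<close>\<close>

fun tm_vars :: "tm \<Rightarrow> nat set" where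
  "tm_vars (Var x) = {x}"
| "tm_vars Zero = {}"
| "tm_vars One = {}"
| "tm_vars (s \<^bold>+ t) = tm_vars s \<union> tm_vars t"
| "tm_vars (s \<^bold>* t) = tm_vars s \<union> tm_vars t"

fun tm_subst :: "nat \<Rightarrow> tm \<Rightarrow> tm \<Rightarrow> tm" where
  "tm_subst x u (Var y) = (if y = x then u else Var y)"
| "tm_subst x u Zero = Zero"
| "tm_subst x u One = One"
| "tm_subst x u (s \<^bold>+ t) = tm_subst x u s \<^bold>+ tm_subst x u t"
| "tm_subst x u (s \<^bold>* t) = tm_subst x u s \<^bold>* tm_subst x u t"

text \<open>Substitution of \<open>u\<close> for the free occurrences of \<open>x\<close>. Bound variables are not renamed; this
  is only used when \<open>u\<close> has no variable other than \<open>x\<close>, and then nothing can be captured.\<close>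

fun subst :: "nat \<Rightarrow> tm \<Rightarrow> form \<Rightarrow> form" where
  "subst x u (s \<^bold>= t) = (tm_subst x u s \<^bold>= tm_subst x u t)"
| "subst x u (s \<^bold>< t) = (tm_subst x u s \<^bold>< tm_subst x u t)"
| "subst x u (t \<^bold>\<in> X) = (tm_subst x u t \<^bold>\<in> X)"
| "subst x u (\<^bold>\<not> \<phi>) = (\<^bold>\<not> subst x u \<phi>)"
| "subst x u (\<phi> \<^bold>\<and> \<psi>) = (subst x u \<phi> \<^bold>\<and> subst x u \<psi>)"
| "subst x u (\<phi> \<^bold>\<or> \<psi>) = (subst x u \<phi> \<^bold>\<or> subst x u \<psi>)"
| "subst x u (\<phi> \<^bold>\<longrightarrow> \<psi>) = (subst x u \<phi> \<^bold>\<longrightarrow> subst x u \<psi>)"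
| "subst x u (\<phi> \<^bold>\<longleftrightarrow> \<psi>) = (subst x u \<phi> \<^bold>\<longleftrightarrow> subst x u \<psi>)"
| "subst x u (AllN y \<phi>) = AllN y (if y = x then \<phi> else subst x u \<phi>)"
| "subst x u (ExN y \<phi>) = ExN y (if y = x then \<phi> else subst x u \<phi>)"
| "subst x u (AllS X \<phi>) = AllS X (subst x u \<phi>)"
| "subst x u (ExS X \<phi>) = ExS X (subst x u \<phi>)"

lemma tm_val_cong: "(\<And>x. x \<in> tm_vars t \<Longrightarrow> e x = e' x) \<Longrightarrow> tm_val M e t = tm_val M e' t"
  by (induction t) auto

lemma tm_val_subst: "tm_val M e (tm_subst x u t) = tm_val M (e(x := tm_val M e u)) t"
  by (induction t) auto

lemma sat_subst:
  assumes "tm_vars u \<subseteq> {x}"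
  shows "sat M e E (subst x u \<phi>) \<longleftrightarrow> sat M (e(x := tm_val M e u)) E \<phi>"
proof (induction \<phi> arbitrary: e E)
  case (AllN y \<phi>)
  have "tm_val M (e(y := a)) u = tm_val M e u" if "y \<noteq> x" for a
    using assms that by (intro tm_val_cong) auto
  then show ?case
    by (cases "y = x") (simp_all add: AllN.IH fun_upd_twist[of y x] del: fun_upd_apply)
next
  case (ExN y \<phi>)
  have "tm_val M (e(y := a)) u = tm_val M e u" if "y \<noteq> x" for a
    using assms that by (intro tm_val_cong) auto
  then show ?case
    by (cases "y = x") (simp_all add: ExN.IH fun_upd_twist[of y x] del: fun_upd_apply)
qed (auto simp: tm_val_subst)

fun free_set_vars :: "form \<Rightarrow> nat set" where
  "free_set_vars (s \<^bold>= t) = {}"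
| "free_set_vars (s \<^bold>< t) = {}"
| "free_set_vars (t \<^bold>\<in> X) = {X}"
| "free_set_vars (\<^bold>\<not> \<phi>) = free_set_vars \<phi>"
| "free_set_vars (\<phi> \<^bold>\<and> \<psi>) = free_set_vars \<phi> \<union> free_set_vars \<psi>"
| "free_set_vars (\<phi> \<^bold>\<or> \<psi>) = free_set_vars \<phi> \<union> free_set_vars \<psi>"
| "free_set_vars (\<phi> \<^bold>\<longrightarrow> \<psi>) = free_set_vars \<phi> \<union> free_set_vars \<psi>"
| "free_set_vars (\<phi> \<^bold>\<longleftrightarrow> \<psi>) = free_set_vars \<phi> \<union> free_set_vars \<psi>"
| "free_set_vars (AllN x \<phi>) = free_set_vars \<phi>"
| "free_set_vars (ExN x \<phi>) = free_set_vars \<phi>"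
| "free_set_vars (AllS X \<phi>) = free_set_vars \<phi> - {X}"
| "free_set_vars (ExS X \<phi>) = free_set_vars \<phi> - {X}"

fun arithmetical :: "form \<Rightarrow> bool" where
  "arithmetical (s \<^bold>= t) \<longleftrightarrow> True"
| "arithmetical (s \<^bold>< t) \<longleftrightarrow> True"
| "arithmetical (t \<^bold>\<in> X) \<longleftrightarrow> True"
| "arithmetical (\<^bold>\<not> \<phi>) \<longleftrightarrow> arithmetical \<phi>"
| "arithmetical (\<phi> \<^bold>\<and> \<psi>) \<longleftrightarrow> arithmetical \<phi> \<and> arithmetical \<psi>"
| "arithmetical (\<phi> \<^bold>\<or> \<psi>) \<longleftrightarrow> arithmetical \<phi> \<and> arithmetical \<psi>"
| "arithmetical (\<phi> \<^bold>\<longrightarrow> \<psi>) \<longleftrightarrow> arithmetical \<phi> \<and> arithmetical \<psi>"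
| "arithmetical (\<phi> \<^bold>\<longleftrightarrow> \<psi>) \<longleftrightarrow> arithmetical \<phi> \<and> arithmetical \<psi>"
| "arithmetical (AllN x \<phi>) \<longleftrightarrow> arithmetical \<phi>"
| "arithmetical (ExN x \<phi>) \<longleftrightarrow> arithmetical \<phi>"
| "arithmetical (AllS X \<phi>) \<longleftrightarrow> False"
| "arithmetical (ExS X \<phi>) \<longleftrightarrow> False"

text \<open>Bounded-quantifier formulas; set parameters are allowed.\<close>

inductive bounded_form :: "form \<Rightarrow> bool" where
  "bounded_form (s \<^bold>= t)"
| "bounded_form (s \<^bold>< t)"
| "bounded_form (t \<^bold>\<in> X)"
| "bounded_form \<phi> \<Longrightarrow> bounded_form (\<^bold>\<not> \<phi>)"
| "bounded_form \<phi> \<Longrightarrow> bounded_form \<psi> \<Longrightarrow> bounded_form (\<phi> \<^bold>\<and> \<psi>)"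
| "bounded_form \<phi> \<Longrightarrow> bounded_form \<psi> \<Longrightarrow> bounded_form (\<phi> \<^bold>\<or> \<psi>)"
| "bounded_form \<phi> \<Longrightarrow> bounded_form \<psi> \<Longrightarrow> bounded_form (\<phi> \<^bold>\<longrightarrow> \<psi>)"
| "bounded_form \<phi> \<Longrightarrow> bounded_form \<psi> \<Longrightarrow> bounded_form (\<phi> \<^bold>\<longleftrightarrow> \<psi>)"
| "bounded_form \<phi> \<Longrightarrow> x \<notin> tm_vars t \<Longrightarrow> bounded_form (AllN x (Var x \<^bold>< t \<^bold>\<longrightarrow> \<phi>))"
| "bounded_form \<phi> \<Longrightarrow> x \<notin> tm_vars t \<Longrightarrow> bounded_form (ExN x (Var x \<^bold>< t \<^bold>\<and> \<phi>))"

definition Sigma01 :: "form set" where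
  "Sigma01 = {ExN x \<theta> | x \<theta>. bounded_form \<theta>}"

definition Pi01 :: "form set" where
  "Pi01 = {AllN x \<theta> | x \<theta>. bounded_form \<theta>}"

text \<open>The axioms of the nonnegative part of a discretely ordered ring.\<close>

definition discrete_ordered_semiring :: "form set" where
  "discrete_ordered_semiring =
    (let x = Var 0; y = Var 1; z = Var 2 in
     { (x \<^bold>+ y) \<^bold>+ z \<^bold>= x \<^bold>+ (y \<^bold>+ z),
       x \<^bold>+ y \<^bold>= y \<^bold>+ x,
       x \<^bold>+ Zero \<^bold>= x,
       (x \<^bold>* y) \<^bold>* z \<^bold>= x \<^bold>* (y \<^bold>* z),
       x \<^bold>* y \<^bold>= y \<^bold>* x,
       x \<^bold>* One \<^bold>= x,
       x \<^bold>* Zero \<^bold>= Zero,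
       x \<^bold>* (y \<^bold>+ z) \<^bold>= x \<^bold>* y \<^bold>+ x \<^bold>* z,
       \<^bold>\<not> (x \<^bold>< x),
       x \<^bold>< y \<^bold>\<and> y \<^bold>< z \<^bold>\<longrightarrow> x \<^bold>< z,
       x \<^bold>< y \<^bold>\<or> x \<^bold>= y \<^bold>\<or> y \<^bold>< x,
       x \<^bold>< y \<^bold>\<longrightarrow> x \<^bold>+ z \<^bold>< y \<^bold>+ z,
       Zero \<^bold>< z \<^bold>\<and> x \<^bold>< y \<^bold>\<longrightarrow> x \<^bold>* z \<^bold>< y \<^bold>* z,
       x \<^bold>< y \<^bold>\<longrightarrow> ExN 2 (x \<^bold>+ z \<^bold>= y),
       Zero \<^bold>= x \<^bold>\<or> Zero \<^bold>< x,
       Zero \<^bold>< One,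
       Zero \<^bold>< x \<^bold>\<longrightarrow> One \<^bold>= x \<^bold>\<or> One \<^bold>< x })"

definition induction_axiom :: "nat \<Rightarrow> form \<Rightarrow> form" where
  "induction_axiom x \<phi> =
     (subst x Zero \<phi> \<^bold>\<and> AllN x (\<phi> \<^bold>\<longrightarrow> subst x (Var x \<^bold>+ One) \<phi>) \<^bold>\<longrightarrow> AllN x \<phi>)"

definition comprehension :: "nat \<Rightarrow> nat \<Rightarrow> form \<Rightarrow> form" where
  "comprehension x X \<phi> = ExS X (AllN x (Var x \<^bold>\<in> X \<^bold>\<longleftrightarrow> \<phi>))"

definition RCA0 :: "form set" where
  "RCA0 = discrete_ordered_semiring
     \<union> {induction_axiom x \<phi> | x \<phi>. \<phi> \<in> Sigma01}
     \<union> {AllN x (\<phi> \<^bold>\<longleftrightarrow> \<psi>) \<^bold>\<longrightarrow> comprehension x X \<phi> | x X \<phi> \<psi>.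
          \<phi> \<in> Sigma01 \<and> \<psi> \<in> Pi01 \<and> X \<notin> free_set_vars \<phi>}"

definition ACA0 :: "form set" where
  "ACA0 = RCA0
     \<union> {comprehension x X \<phi> | x X \<phi>. arithmetical \<phi> \<and> X \<notin> free_set_vars \<phi>}"


section \<open>The principle \<open>FIP\<close>\<close>

text \<open>A set \<open>A\<close> codes the family of its columns \<open>{x. (i, x) \<in> A}\<close>, with the usual pairing
  \<open>(i, x) = (i + x)\<^sup>2 + i\<close> of second-order arithmetic. In the formulas below, set variables
  are parameters, and the terms passed as parameters must not contain \<open>Var 0\<close>, which
  serves as the bound variable.\<close>

definition pair_tm :: "tm \<Rightarrow> tm \<Rightarrow> tm" where
  "pair_tm i x = (i \<^bold>+ x) \<^bold>* (i \<^bold>+ x) \<^bold>+ i"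

definition nontrivial_form :: "nat \<Rightarrow> form" where
  "nontrivial_form A = ExN 1 (ExN 0 (pair_tm (Var 1) (Var 0) \<^bold>\<in> A))"

definition same_member :: "nat \<Rightarrow> tm \<Rightarrow> nat \<Rightarrow> tm \<Rightarrow> form" where
  "same_member A i B j = AllN 0 (pair_tm i (Var 0) \<^bold>\<in> A \<^bold>\<longleftrightarrow> pair_tm j (Var 0) \<^bold>\<in> B)"

definition subfamily_form :: "nat \<Rightarrow> nat \<Rightarrow> form" where
  "subfamily_form B A = AllN 1 (ExN 2 (same_member B (Var 1) A (Var 2)))"

text \<open>Finite sequences are coded by pairs of numbers via Goedel's beta function: the following says
  that \<open>u\<close> is the remainder of \<open>a\<close> modulo \<open>1 + (i + 1) * b\<close>.\<close>

definition beta_form :: "tm \<Rightarrow> tm \<Rightarrow> tm \<Rightarrow> tm \<Rightarrow> form" where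
  "beta_form a b i u =
     (let d = One \<^bold>+ (i \<^bold>+ One) \<^bold>* b in ExN 0 (a \<^bold>= Var 0 \<^bold>* d \<^bold>+ u) \<^bold>\<and> u \<^bold>< d)"

text \<open>For every \<open>m \<ge> 2\<close> and every sequence of indices of length \<open>m\<close> (coded by \<open>a\<close>, \<open>b\<close>) whose
  members are pairwise distinct, the intersection of these members is nonempty.\<close>

definition F_intersection_form :: "nat \<Rightarrow> form" where
  "F_intersection_form A =
    (let m = Var 1; a = Var 2; b = Var 3; i = Var 4; j = Var 5; u = Var 6; v = Var 7; x = Var 8 in
     AllN 1 (One \<^bold>< m \<^bold>\<longrightarrow> AllN 2 (AllN 3 (
       AllN 4 (AllN 5 (i \<^bold>< j \<^bold>\<and> j \<^bold>< m \<^bold>\<longrightarrow>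
         AllN 6 (AllN 7 (beta_form a b i u \<^bold>\<and> beta_form a b j v \<^bold>\<longrightarrow> \<^bold>\<not> same_member A u A v))))
       \<^bold>\<longrightarrow>
       ExN 8 (AllN 4 (i \<^bold>< m \<^bold>\<longrightarrow> AllN 6 (beta_form a b i u \<^bold>\<longrightarrow> pair_tm u x \<^bold>\<in> A)))))))"

definition FIP :: form where
  "FIP =
    (let A = 0; B = 1; C = 2 in
     AllS A (nontrivial_form A \<^bold>\<longrightarrow>
       ExS B (subfamily_form B A \<^bold>\<and> F_intersection_form B \<^bold>\<and>
         AllS C (subfamily_form C A \<^bold>\<and> F_intersection_form C \<^bold>\<and> subfamily_form B C
           \<^bold>\<longrightarrow> subfamily_form C B))))"


subsection \<open>Meaning of \<open>FIP\<close> in \<open>\<omega>\<close>-models\<close>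

definition member :: "nat set \<Rightarrow> nat \<Rightarrow> nat set" where
  "member A i = {x. (i + x)\<^sup>2 + i \<in> A}"

definition nontrivial :: "nat set \<Rightarrow> bool" where
  "nontrivial A \<longleftrightarrow> (\<exists>i. member A i \<noteq> {})"

definition subfamily :: "nat set \<Rightarrow> nat set \<Rightarrow> bool" where
  "subfamily B A \<longleftrightarrow> (\<forall>i. \<exists>j. member B i = member A j)"

definition F_intersection :: "nat set \<Rightarrow> bool" where
  "F_intersection A \<longleftrightarrow>
     (\<forall>m\<ge>2. \<forall>F \<subseteq> range (member A). finite F \<and> card F = m \<longrightarrow> \<Inter>F \<noteq> {})"

lemma beta_mod: "(\<exists>q. a = q * Suc d + u) \<and> u < Suc d \<longleftrightarrow> u = a mod Suc d" for a :: nat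
proof
  assume "(\<exists>q. a = q * Suc d + u) \<and> u < Suc d"
  then obtain q where "a = q * Suc d + u" "u < Suc d" by blast
  then show "u = a mod Suc d" by (metis mod_less mod_mult_self3)
next
  assume "u = a mod Suc d"
  moreover have "a = (a div Suc d) * Suc d + a mod Suc d" by (metis div_mult_mod_eq)
  ultimately show "(\<exists>q. a = q * Suc d + u) \<and> u < Suc d" by (metis mod_less_divisor zero_less_Suc)
qed

lemma beta_complete:
  fixes s :: "nat \<Rightarrow> nat"
  shows "\<exists>a b. \<forall>i<m. a mod Suc (Suc i * b) = s i"
proof -
  define K where "K = Suc (m + (\<Sum>i<m. s i))"
  define b where "b = (fact K :: nat)"
  have cop: "coprime (Suc (Suc i * b)) (Suc (Suc j * b))" if "i < j" "j < m" for i j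
  proof (rule ccontr)
    assume "\<not> ?thesis"
    then have "gcd (Suc (Suc i * b)) (Suc (Suc j * b)) \<noteq> 1"
      by (simp only: coprime_iff_gcd_eq_1 not_False_eq_True)
    then obtain p where "prime p" "p dvd gcd (Suc (Suc i * b)) (Suc (Suc j * b))"
      using prime_factor_nat by blast
    then have p: "prime p" "p dvd Suc (Suc i * b)" "p dvd Suc (Suc j * b)"
      by (simp_all only: gcd_greatest_iff)
    have "Suc (Suc j * b) - Suc (Suc i * b) = (j - i) * b"
      using that by (simp add: diff_mult_distrib)
    then have "p dvd (j - i) * b" using p by (metis dvd_diff_nat)
    then consider "p dvd j - i" | "p dvd b" using p(1) prime_dvd_mult_iff by blast
    then have "p dvd b"
    proof cases
      case 1
      then have "p \<le> K" using that by (auto dest!: dvd_imp_le simp: K_def)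
      then show ?thesis using p(1) by (simp add: b_def prime_dvd_fact_iff)
    qed
    then have "p dvd Suc i * b" by (rule dvd_mult)
    with p(2) have "p dvd Suc (Suc i * b) - Suc i * b" by (rule dvd_diff_nat)
    then have "p dvd 1" by (simp only: Suc_diff_Suc diff_self_eq_0 Suc_diff_le[OF order_refl] One_nat_def)
    then show False using p(1) not_prime_unit by blast
  qed
  have "\<exists>a. \<forall>i\<in>{..<m}. [a = s i] (mod Suc (Suc i * b))"
  proof (rule chinese_remainder_nat)
    show "\<forall>i\<in>{..<m}. \<forall>j\<in>{..<m}. i \<noteq> j \<longrightarrow> coprime (Suc (Suc i * b)) (Suc (Suc j * b))"
      using cop by (metis coprime_commute lessThan_iff nat_neq_iff)
  qed simp
  then obtain a where a: "\<forall>i\<in>{..<m}. [a = s i] (mod Suc (Suc i * b))" by blast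
  have "a mod Suc (Suc i * b) = s i" if "i < m" for i
  proof -
    have "s i \<le> (\<Sum>i<m. s i)" using that by (intro member_le_sum) auto
    then have "s i \<le> K" by (simp add: K_def)
    also have "K \<le> b" unfolding b_def by (rule fact_ge_self)
    finally have "s i < Suc (Suc i * b)" by simp
    with a that show ?thesis by (auto simp: cong_def)
  qed
  then show ?thesis by blast
qed

lemma sat_beta_form:
  assumes "0 \<notin> tm_vars a \<union> tm_vars b \<union> tm_vars i \<union> tm_vars u"
  shows "sat (omega S) e E (beta_form a b i u) \<longleftrightarrow>
    tm_val (omega S) e u =
      tm_val (omega S) e a mod Suc (Suc (tm_val (omega S) e i) * tm_val (omega S) e b)"
proof -
  have "tm_val (omega S) (e(0 := q)) t = tm_val (omega S) e t"
    if "t \<in> {a, b, i, u}" for q t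
    using assms that by (intro tm_val_cong) auto
  then show ?thesis
    by (simp add: beta_form_def Let_def beta_mod[symmetric])
qed

lemma sat_same_member:
  assumes "0 \<notin> tm_vars i \<union> tm_vars j"
  shows "sat (omega S) e E (same_member A i B j) \<longleftrightarrow>
    member (E A) (tm_val (omega S) e i) = member (E B) (tm_val (omega S) e j)"
proof -
  have "tm_val (omega S) (e(0 := q)) t = tm_val (omega S) e t" if "t \<in> {i, j}" for q t
    using assms that by (intro tm_val_cong) auto
  then show ?thesis
    by (auto simp: same_member_def pair_tm_def member_def power2_eq_square)
qed

lemma F_intersection_sequences:
  "F_intersection A \<longleftrightarrow>
    (\<forall>m::nat>1. \<forall>s. (\<forall>i j. i < j \<and> j < m \<longrightarrow> member A (s i) \<noteq> member A (s j))
       \<longrightarrow> (\<exists>x. \<forall>i<m. x \<in> member A (s i)))"  (is "_ \<longleftrightarrow> ?R")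
proof
  assume F: "F_intersection A"
  show ?R
  proof (intro allI impI)
    fix m :: nat and s
    assume m: "1 < m" and dist: "\<forall>i j. i < j \<and> j < m \<longrightarrow> member A (s i) \<noteq> member A (s j)"
    let ?F = "(\<lambda>i. member A (s i)) ` {..<m}"
    have "inj_on (\<lambda>i. member A (s i)) {..<m}"
      using dist by (intro inj_onI) (metis lessThan_iff nat_neq_iff)
    then have "card ?F = m" by (simp add: card_image)
    moreover have "?F \<subseteq> range (member A)" by auto
    ultimately have "\<Inter>?F \<noteq> {}" using F m unfolding F_intersection_def
      by (metis Suc_1 Suc_leI finite_imageI finite_lessThan)
    then show "\<exists>x. \<forall>i<m. x \<in> member A (s i)" by auto
  qed
next
  assume R: ?R
  show "F_intersection A" unfolding F_intersection_def
  proof (intro allI impI)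
    fix m :: nat and F
    assume m: "2 \<le> m" and F: "F \<subseteq> range (member A)" and fin: "finite F \<and> card F = m"
    then obtain h where h: "bij_betw h {..<m} F"
      by (metis ex_bij_betw_nat_finite lessThan_atLeast0)
    have "\<forall>i<m. \<exists>k. h i = member A k" using h F by (auto simp: bij_betw_def)
    then obtain s where s: "\<forall>i<m. h i = member A (s i)" by metis
    have "\<forall>i j. i < j \<and> j < m \<longrightarrow> member A (s i) \<noteq> member A (s j)"
    proof (intro allI impI)
      fix i j assume ij: "i < j \<and> j < m"
      then have "h i \<noteq> h j" using h
        by (metis bij_betw_def inj_on_eq_iff lessThan_iff less_irrefl order_less_trans)
      then show "member A (s i) \<noteq> member A (s j)" using s ij by auto
    qed
    then obtain x where "\<forall>i<m. x \<in> member A (s i)" using R m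
      by (metis Suc_1 Suc_le_lessD)
    then have "x \<in> \<Inter>F" using s h by (auto simp: bij_betw_def)
    then show "\<Inter>F \<noteq> {}" by auto
  qed
qed

lemma sat_F_intersection_form:
  "sat (omega S) e E (F_intersection_form A) \<longleftrightarrow> F_intersection (E A)"
proof -
  have "sat (omega S) e E (F_intersection_form A) \<longleftrightarrow>
    (\<forall>m>1. \<forall>a b. (\<forall>i j. i < j \<and> j < m \<longrightarrow>
        member (E A) (a mod Suc (Suc i * b)) \<noteq> member (E A) (a mod Suc (Suc j * b)))
      \<longrightarrow> (\<exists>x. \<forall>i<m. x \<in> member (E A) (a mod Suc (Suc i * b))))"
    by (simp add: F_intersection_form_def Let_def sat_beta_form sat_same_member del: mult_Suc)
       (simp add: pair_tm_def member_def power2_eq_square del: mult_Suc)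
  also have "\<dots> \<longleftrightarrow> F_intersection (E A)"
    unfolding F_intersection_sequences
  proof safe
    fix m s
    assume H: "\<forall>m>1. \<forall>a b. (\<forall>i j. i < j \<and> j < m \<longrightarrow>
        member (E A) (a mod Suc (Suc i * b)) \<noteq> member (E A) (a mod Suc (Suc j * b)))
      \<longrightarrow> (\<exists>x. \<forall>i<m. x \<in> member (E A) (a mod Suc (Suc i * b)))"
      and m: "(1::nat) < m"
      and dist: "\<forall>i j. i < j \<and> j < m \<longrightarrow> member (E A) (s i) \<noteq> member (E A) (s j)"
    obtain a b where ab: "\<forall>i<m. a mod Suc (Suc i * b) = s i" using beta_complete by blast
    then have "\<forall>i j. i < j \<and> j < m \<longrightarrow>
        member (E A) (a mod Suc (Suc i * b)) \<noteq> member (E A) (a mod Suc (Suc j * b))"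
      using dist by (metis order_less_trans)
    then have "\<exists>x. \<forall>i<m. x \<in> member (E A) (a mod Suc (Suc i * b))" using H m by blast
    then show "\<exists>x. \<forall>i<m. x \<in> member (E A) (s i)" using ab by metis
  next
    fix m a b
    assume H: "\<forall>m::nat>1. \<forall>s. (\<forall>i j. i < j \<and> j < m \<longrightarrow> member (E A) (s i) \<noteq> member (E A) (s j))
       \<longrightarrow> (\<exists>x. \<forall>i<m. x \<in> member (E A) (s i))"
      and "(1::nat) < m"
      and "\<forall>i j. i < j \<and> j < m \<longrightarrow>
        member (E A) (a mod Suc (Suc i * b)) \<noteq> member (E A) (a mod Suc (Suc j * b))"
    then show "\<exists>x. \<forall>i<m. x \<in> member (E A) (a mod Suc (Suc i * b))"
      using H[rule_format, of m "\<lambda>i. a mod Suc (Suc i * b)"] by blast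
  qed
  finally show ?thesis .
qed

lemma sat_subfamily_form:
  "sat (omega S) e E (subfamily_form B A) \<longleftrightarrow> subfamily (E B) (E A)"
  by (simp add: subfamily_form_def subfamily_def sat_same_member)

lemma omega_models_FIP:
  "omega S \<Turnstile> {FIP} \<longleftrightarrow> S \<noteq> {} \<and>
    (\<forall>A\<in>S. nontrivial A \<longrightarrow>
      (\<exists>B\<in>S. subfamily B A \<and> F_intersection B \<and>
        (\<forall>C\<in>S. subfamily C A \<and> F_intersection C \<and> subfamily B C \<longrightarrow> subfamily C B)))"
proof -
  have 1: "sat (omega S) e E (nontrivial_form A) \<longleftrightarrow> nontrivial (E A)" for e E A
    by (simp add: nontrivial_form_def nontrivial_def member_def pair_tm_def
        power2_eq_square)
  have 3: "\<exists>E :: nat \<Rightarrow> nat set. \<forall>X. E X \<in> S" if "S \<noteq> {}"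
  proof -
    from that obtain A where "A \<in> S" by blast
    then show ?thesis by (intro exI[of _ "\<lambda>_. A"]) simp
  qed
  show ?thesis using 3
    by (auto simp: models_def FIP_def Let_def 1 sat_F_intersection_form sat_subfamily_form)
qed


section \<open>Relative computability\<close>

text \<open>Oracle programs for the partial functions \<open>\<nat> \<rightarrow> \<nat>\<close> recursive in a set; several arguments are
  passed through the pairing function \<^const>\<open>prod_encode\<close>.\<close>

datatype prog =
    PZero
  | PSucc
  | PLeft
  | PRight
  | POracle
  | PPair prog prog
  | PComp prog prog
  | PPrec prog prog
  | PMu prog

text \<open>\<open>computes X p n m\<close>: with oracle \<open>X\<close>, program \<open>p\<close> halts on input \<open>n\<close> with output \<open>m\<close>.\<close>

inductive computes :: "nat set \<Rightarrow> prog \<Rightarrow> nat \<Rightarrow> nat \<Rightarrow> bool" for X where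
  "computes X PZero n 0"
| "computes X PSucc n (Suc n)"
| "computes X PLeft (prod_encode (a, b)) a"
| "computes X PRight (prod_encode (a, b)) b"
| "computes X POracle n (if n \<in> X then 1 else 0)"
| "computes X p n a \<Longrightarrow> computes X q n b \<Longrightarrow> computes X (PPair p q) n (prod_encode (a, b))"
| "computes X q n k \<Longrightarrow> computes X p k m \<Longrightarrow> computes X (PComp p q) n m"
| "computes X p a m \<Longrightarrow> computes X (PPrec p q) (prod_encode (a, 0)) m"
| "computes X (PPrec p q) (prod_encode (a, k)) r \<Longrightarrow>
   computes X q (prod_encode (a, prod_encode (k, r))) m \<Longrightarrow>
   computes X (PPrec p q) (prod_encode (a, Suc k)) m"
| "computes X p (prod_encode (a, k)) 0 \<Longrightarrow>
   (\<forall>j<k. \<exists>r. computes X p (prod_encode (a, j)) (Suc r)) \<Longrightarrow>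
   computes X (PMu p) a k"

definition turing_le :: "nat set \<Rightarrow> nat set \<Rightarrow> bool"  (infix "\<le>\<^sub>T" 50) where
  "X \<le>\<^sub>T Y \<longleftrightarrow> (\<exists>p. \<forall>n. computes Y p n (if n \<in> X then 1 else 0))"

text \<open>An effective numbering of the programs.\<close>

fun prog_index :: "prog \<Rightarrow> nat" where
  "prog_index PZero = 0"
| "prog_index PSucc = 1"
| "prog_index PLeft = 2"
| "prog_index PRight = 3"
| "prog_index POracle = 4"
| "prog_index (PPair p q) = 5 + 4 * prod_encode (prog_index p, prog_index q)"
| "prog_index (PComp p q) = 6 + 4 * prod_encode (prog_index p, prog_index q)"
| "prog_index (PPrec p q) = 7 + 4 * prod_encode (prog_index p, prog_index q)"
| "prog_index (PMu p) = 8 + 4 * prog_index p"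

lemma prog_index_distinct:
  fixes a b :: nat
  shows "5 + 4 * a \<noteq> 6 + 4 * b" "5 + 4 * a \<noteq> 7 + 4 * b" "5 + 4 * a \<noteq> 8 + 4 * b"
    "6 + 4 * a \<noteq> 7 + 4 * b" "6 + 4 * a \<noteq> 8 + 4 * b" "7 + 4 * a \<noteq> 8 + 4 * b"
  by presburger+

lemma bij_prog_index: "bij prog_index"
proof (rule bijI)
  show "inj prog_index"
  proof (rule injI)
    fix p q show "prog_index p = prog_index q \<Longrightarrow> p = q"
    proof (induction p arbitrary: q)
      case (PPair p1 p2)
      then show ?case
        by (cases q) (simp_all add: prog_index_distinct prog_index_distinct[symmetric])
    next
      case (PComp p1 p2)
      then show ?case
        by (cases q) (simp_all add: prog_index_distinct prog_index_distinct[symmetric])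
    next
      case (PPrec p1 p2)
      then show ?case
        by (cases q) (simp_all add: prog_index_distinct prog_index_distinct[symmetric])
    next
      case (PMu p)
      then show ?case
        by (cases q) (simp_all add: prog_index_distinct prog_index_distinct[symmetric])
    qed (case_tac q; simp)+
  qed
  have "\<exists>p. prog_index p = n" for n
  proof (induction n rule: less_induct)
    case (less n)
    consider "n = 0" | "n = 1" | "n = 2" | "n = 3" | "n = 4" | "n \<ge> 5" by linarith
    then show ?case
    proof cases
      case 6
      define k where "k = (n - 5) div 4"
      obtain a b where ab: "k = prod_encode (a, b)" by (metis prod_decode_inverse surj_pair)
      have "k < n" using 6 unfolding k_def by linarith
      moreover have "a \<le> k" "b \<le> k" unfolding ab by (rule le_prod_encode_1 le_prod_encode_2)+
      ultimately obtain p q r where "prog_index p = a" "prog_index q = b" "prog_index r = k"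
        using less by (meson le_less_trans)
      moreover have "n = 5 + 4 * k \<or> n = 6 + 4 * k \<or> n = 7 + 4 * k \<or> n = 8 + 4 * k"
        using 6 unfolding k_def by presburger
      ultimately show ?thesis using ab
        by (metis prog_index.simps(6) prog_index.simps(7) prog_index.simps(8) prog_index.simps(9))
    qed (metis prog_index.simps)+
  qed
  then show "surj prog_index" by (metis surjI surj_def)
qed

definition jump :: "nat set \<Rightarrow> nat set" where
  "jump X = {prog_index p | p. \<exists>m. computes X p (prog_index p) m}"

definition low :: "nat set \<Rightarrow> bool" where
  "low X \<longleftrightarrow> jump X \<le>\<^sub>T jump {}"

end

theory Submission
  imports Defs
begin

text \<open>
  One low set \<open>G\<close> carries the whole model. Split \<open>G\<close> into columns, let \<open>G\<^sub>n\<close> consist of the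
  columns up to \<open>n\<close>, and let the sets of the model be those computable from some \<open>G\<^sub>n\<close>. They form a
  Turing ideal, so the model satisfies \<open>RCA\<^sub>0\<close>, and all of them are low because \<open>G\<close> is.

  The set \<open>G\<close> is 1-generic: for every program, a finite part of \<open>G\<close> either makes the program halt on
  its own index or prevents it from halting for every oracle that extends this part. Such a set is
  the limit of finite conditions, each of which extends the previous one so as to make the next
  program halt whenever this is possible. An oracle for the halting problem can carry out the
  construction, and reads off from each stage whether the program halts relative to \<open>G\<close>; this is
  lowness.

  For \<open>FIP\<close>, let the family \<open>A\<close> be computable from \<open>G\<^sub>n\<close>. If some member of \<open>A\<close> is empty, then the
  family consisting of the empty set alone is maximal, since the empty set meets nothing. Otherwise
  regard the elements of column \<open>n + 1\<close> as proposals \<open>(j, x)\<close> to add the \<open>j\<close>-th member of \<open>A\<close>, and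
  accept a proposal when \<open>x\<close> lies in this member and in all members accepted before. The accepted
  members form a family computable from \<open>G\<^sub>n\<^sub>+\<^sub>1\<close>, and the witness of the last proposal among
  finitely many accepted ones lies in all of them. If the \<open>j\<close>-th member is never accepted, then a
  finite part of \<open>G\<close> prevents its acceptance. A family with the intersection property that contains
  the \<open>j\<close>-th member and the accepted ones would supply a common point \<open>x\<close> of the \<open>j\<close>-th member and the
  finitely many members accepted within that part, and the proposal \<open>(j, x)\<close> could then be appended
  to that part without touching the columns that compute \<open>A\<close>, a contradiction
  (\<open>subfamily_of_chosen\<close>).

  Finally, the halting problem is arithmetically definable, so a model of \<open>ACA\<^sub>0\<close> with standard
  numbers contains it. But it is not low, because no set computes its own jump.\<close>

section \<open>Computable functions and decidable relations, uniformly in the oracle\<close>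

definition pfst :: "nat \<Rightarrow> nat" where "pfst z = fst (prod_decode z)"
definition psnd :: "nat \<Rightarrow> nat" where "psnd z = snd (prod_decode z)"

lemma pfst_encode [simp]: "pfst (prod_encode (a, b)) = a"
  and psnd_encode [simp]: "psnd (prod_encode (a, b)) = b"
  by (simp_all add: pfst_def psnd_def)

lemma prod_encode_pfst_psnd [simp]: "prod_encode (pfst z, psnd z) = z"
  by (simp add: pfst_def psnd_def)

text \<open>The functionals \<open>f\<close> take the oracle as an argument, and one program has to serve all oracles
  in \<open>K\<close>. This uniformity is what genericity requires: it is applied to a program that has to compute
  correctly not only from the generic set, but from every oracle that shares certain columns with
  it. With a singleton \<open>K\<close> one recovers computability relative to a fixed set.\<close>

definition computable :: "nat set set \<Rightarrow> (nat set \<Rightarrow> nat \<Rightarrow> nat) \<Rightarrow> bool" where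
  "computable K f \<longleftrightarrow> (\<exists>p. \<forall>X\<in>K. \<forall>n. computes X p n (f X n))"

definition decidable :: "nat set set \<Rightarrow> (nat set \<Rightarrow> nat \<Rightarrow> bool) \<Rightarrow> bool" where
  "decidable K P \<longleftrightarrow> computable K (\<lambda>X n. of_bool (P X n))"

lemma turing_le_iff_decidable: "Y \<le>\<^sub>T X \<longleftrightarrow> decidable {X} (\<lambda>_ n. n \<in> Y)"
  by (simp add: turing_le_def decidable_def computable_def of_bool_def)

lemma computable_cong:
  assumes "computable K f" "\<And>X n. X \<in> K \<Longrightarrow> f X n = g X n"
  shows "computable K g"
  using assms by (simp add: computable_def)

lemma decidable_cong:
  assumes "decidable K P" "\<And>X n. X \<in> K \<Longrightarrow> P X n \<longleftrightarrow> Q X n"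
  shows "decidable K Q"
  using assms by (simp add: decidable_def computable_def)

lemma computes_left: "computes X PLeft n (pfst n)"
  and computes_right: "computes X PRight n (psnd n)"
  using computes.intros(3,4)[of X "pfst n" "psnd n"] by simp_all

definition pid :: prog where "pid = PPair PLeft PRight"

lemma computes_pid: "computes X pid n n"
  using computes.intros(6)[OF computes_left computes_right, of X n] by (simp add: pid_def)

primrec pconst :: "nat \<Rightarrow> prog" where
  "pconst 0 = PZero"
| "pconst (Suc c) = PComp PSucc (pconst c)"

lemma computes_pconst: "computes X (pconst c) n c"
  by (induction c) (auto intro: computes.intros)

lemma computable_id: "computable K (\<lambda>X z. z)"
  using computes_pid by (auto simp: computable_def)

lemma computable_const: "computable K (\<lambda>X z. c)"
  using computes_pconst by (auto simp: computable_def)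

lemma computable_comp:
  assumes "computable K g" "computable K f"
  shows "computable K (\<lambda>X z. g X (f X z))"
  using assms unfolding computable_def by (meson computes.intros(7))

lemma computable_Suc: "computable K f \<Longrightarrow> computable K (\<lambda>X z. Suc (f X z))"
  by (rule computable_comp) (auto simp: computable_def intro: computes.intros)

lemma computable_pfst: "computable K f \<Longrightarrow> computable K (\<lambda>X z. pfst (f X z))"
  by (rule computable_comp) (auto simp: computable_def intro: computes_left)

lemma computable_psnd: "computable K f \<Longrightarrow> computable K (\<lambda>X z. psnd (f X z))"
  by (rule computable_comp) (auto simp: computable_def intro: computes_right)

lemmas computable_pfst_id = computable_pfst[OF computable_id]
  and computable_psnd_id = computable_psnd[OF computable_id]

lemma computable_pair:
  assumes "computable K f" "computable K g"
  shows "computable K (\<lambda>X z. prod_encode (f X z, g X z))"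
  using assms unfolding computable_def by (meson computes.intros(6))

lemma computes_prec:
  assumes "computes X p a c"
    and "\<And>k r. computes X q (prod_encode (a, prod_encode (k, r))) (s k r)"
  shows "computes X (PPrec p q) (prod_encode (a, k)) (rec_nat c s k)"
  using assms by (induction k) (auto intro: computes.intros)

lemma computable_prec:
  assumes a: "computable K a"
    and s: "computable K (\<lambda>X w. s X (pfst w) (pfst (psnd w)) (psnd (psnd w)))"
    and t: "computable K t"
  shows "computable K (\<lambda>X z. rec_nat (a X z) (\<lambda>k r. s X z k r) (t X z))"
proof -
  obtain pa ps where pa: "\<forall>X\<in>K. \<forall>n. computes X pa n (a X n)"
    and ps: "\<forall>X\<in>K. \<forall>w. computes X ps w (s X (pfst w) (pfst (psnd w)) (psnd (psnd w)))"
    using a s unfolding computable_def by blast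
  have "computes X (PPrec pa ps) (prod_encode (z, k)) (rec_nat (a X z) (\<lambda>k r. s X z k r) k)"
    if X: "X \<in> K" for X z k
  proof (rule computes_prec)
    show "computes X pa z (a X z)" using pa X by blast
    show "computes X ps (prod_encode (z, prod_encode (k, r))) (s X z k r)" for k r
      using ps[rule_format, OF X, of "prod_encode (z, prod_encode (k, r))"] by simp
  qed
  then have "computes X (PPrec pa ps) w
      (rec_nat (a X (pfst w)) (\<lambda>k r. s X (pfst w) k r) (psnd w))" if "X \<in> K" for X w
    using that by (metis prod_encode_pfst_psnd)
  then have "computable K (\<lambda>X w. rec_nat (a X (pfst w)) (\<lambda>k r. s X (pfst w) k r) (psnd w))"
    unfolding computable_def by blast
  from computable_comp[OF this computable_pair[OF computable_id t]] show ?thesis by simp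
qed

lemma computable_add:
  assumes "computable K f" "computable K g"
  shows "computable K (\<lambda>X z. f X z + g X z)"
proof -
  have "rec_nat m (\<lambda>_. Suc) n = m + n" for m n by (induction n) auto
  then show ?thesis
    using computable_prec[of K f "\<lambda>_ _ _ r. Suc r" g] assms
    by (simp add: computable_Suc computable_psnd computable_id)
qed

lemma computable_mult:
  assumes "computable K f" "computable K g"
  shows "computable K (\<lambda>X z. f X z * g X z)"
proof -
  have "rec_nat 0 (\<lambda>_ r. r + m) n = m * n" for m n :: nat by (induction n) auto
  then show ?thesis
    using computable_prec[of K "\<lambda>_ _. 0" "\<lambda>X z _ r. r + f X z" g]
      computable_comp[OF assms(1)] assms
    by (simp add: computable_add computable_pfst computable_psnd computable_id computable_const)
qed

lemma computable_power:
  assumes "computable K f" "computable K g"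
  shows "computable K (\<lambda>X z. f X z ^ g X z)"
proof -
  have "rec_nat 1 (\<lambda>_ r. r * m) n = m ^ n" for m n :: nat by (induction n) auto
  then show ?thesis
    using computable_prec[of K "\<lambda>_ _. 1" "\<lambda>X z _ r. r * f X z" g]
      computable_comp[OF assms(1)] assms
    by (simp add: computable_mult computable_pfst computable_psnd computable_id computable_const)
qed

lemma computable_pred:
  assumes "computable K g"
  shows "computable K (\<lambda>X z. g X z - 1)"
proof -
  have "rec_nat 0 (\<lambda>k _. k) n = n - 1" for n :: nat by (induction n) auto
  then show ?thesis
    using computable_prec[of K "\<lambda>_ _. 0" "\<lambda>X z k _. k" g] assms
    by (simp add: computable_pfst computable_psnd computable_id computable_const)
qed

lemma computable_diff:
  assumes "computable K f" "computable K g"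
  shows "computable K (\<lambda>X z. f X z - g X z)"
proof -
  have "rec_nat m (\<lambda>_ r. r - 1) n = m - n" for m n :: nat by (induction n) auto
  then show ?thesis
    using computable_prec[of K f "\<lambda>_ _ _ r. r - 1" g] assms
      computable_pred[of K "\<lambda>_ w. psnd (psnd w)"]
    by (simp add: computable_psnd computable_id)
qed

lemma decidable_not:
  assumes "decidable K P"
  shows "decidable K (\<lambda>X z. \<not> P X z)"
proof -
  have "computable K (\<lambda>X z. 1 - of_bool (P X z))"
    using assms unfolding decidable_def by (intro computable_diff computable_const)
  then show ?thesis unfolding decidable_def by (rule computable_cong) simp
qed

lemma decidable_conj:
  assumes "decidable K P" "decidable K Q"
  shows "decidable K (\<lambda>X z. P X z \<and> Q X z)"
  using computable_mult[of K "\<lambda>X z. of_bool (P X z)" "\<lambda>X z. of_bool (Q X z)"] assms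
  by (simp add: decidable_def of_bool_conj)

lemma decidable_disj:
  assumes "decidable K P" "decidable K Q"
  shows "decidable K (\<lambda>X z. P X z \<or> Q X z)"
proof -
  have "decidable K (\<lambda>X z. \<not> (\<not> P X z \<and> \<not> Q X z))"
    using assms by (intro decidable_not decidable_conj)
  then show ?thesis by simp
qed

lemma decidable_imp:
  assumes "decidable K P" "decidable K Q"
  shows "decidable K (\<lambda>X z. P X z \<longrightarrow> Q X z)"
  using assms unfolding imp_conv_disj by (intro decidable_disj decidable_not)

lemma decidable_iff:
  assumes "decidable K P" "decidable K Q"
  shows "decidable K (\<lambda>X z. P X z \<longleftrightarrow> Q X z)"
  using assms unfolding iff_conv_conj_imp by (intro decidable_conj decidable_imp)

lemma decidable_le:
  assumes "computable K f" "computable K g"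
  shows "decidable K (\<lambda>X z. f X z \<le> g X z)"
proof -
  have "computable K (\<lambda>X z. 1 - (f X z - g X z))"
    using assms by (intro computable_diff computable_const)
  then show ?thesis unfolding decidable_def by (rule computable_cong) simp
qed

lemma decidable_less:
  assumes "computable K f" "computable K g"
  shows "decidable K (\<lambda>X z. f X z < g X z)"
  using assms unfolding Suc_le_eq[symmetric] by (intro decidable_le computable_Suc)

lemma decidable_eq:
  assumes "computable K f" "computable K g"
  shows "decidable K (\<lambda>X z. f X z = g X z)"
  using assms unfolding eq_iff[of "f _ _"] by (intro decidable_conj decidable_le)

lemma decidable_comp:
  assumes "decidable K P" "computable K f"
  shows "decidable K (\<lambda>X z. P X (f X z))"
  using computable_comp[of K "\<lambda>X n. of_bool (P X n)"] assms by (simp add: decidable_def)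

lemma decidable_oracle:
  assumes "computable K f"
  shows "decidable K (\<lambda>X z. f X z \<in> X)"
proof (rule decidable_comp[OF _ assms])
  have "computes X POracle n (of_bool (n \<in> X))" for X n
    using computes.intros(5)[of X n] by (simp add: of_bool_def)
  then show "decidable K (\<lambda>X z. z \<in> X)"
    unfolding decidable_def computable_def by blast
qed

lemma decidable_const: "decidable K (\<lambda>X z. P)"
  unfolding decidable_def by (rule computable_const)

lemma computable_if:
  assumes "decidable K P" "computable K f" "computable K g"
  shows "computable K (\<lambda>X z. if P X z then f X z else g X z)"
proof -
  have "computable K (\<lambda>X z. of_bool (P X z) * f X z + (1 - of_bool (P X z)) * g X z)"
    using assms unfolding decidable_def
    by (intro computable_add computable_mult computable_diff computable_const)
  then show ?thesis by (rule computable_cong) simp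
qed

lemma computes_mu:
  assumes p: "\<And>k. computes X p (prod_encode (a, k)) (of_bool (\<not> P k))" and "P k0"
  shows "computes X (PMu p) a (LEAST k. P k)"
proof (rule computes.intros(10))
  have "P (LEAST k. P k)" using assms(2) by (rule LeastI)
  then show "computes X p (prod_encode (a, LEAST k. P k)) 0"
    using p[of "LEAST k. P k"] by simp
  show "\<forall>j<LEAST k. P k. \<exists>r. computes X p (prod_encode (a, j)) (Suc r)"
  proof (intro allI impI)
    fix j assume "j < (LEAST k. P k)"
    then have "\<not> P j" by (rule not_less_Least)
    then show "\<exists>r. computes X p (prod_encode (a, j)) (Suc r)"
      using p[of j] by (auto intro!: exI[of _ 0])
  qed
qed

lemma computable_Least:
  assumes P: "decidable K (\<lambda>X w. P X (pfst w) (psnd w))"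
    and ex: "\<And>X z. X \<in> K \<Longrightarrow> \<exists>y. P X z y"
  shows "computable K (\<lambda>X z. LEAST y. P X z y)"
proof -
  obtain p where p: "\<forall>X\<in>K. \<forall>w. computes X p w (of_bool (\<not> P X (pfst w) (psnd w)))"
    using decidable_not[OF P] unfolding decidable_def computable_def by blast
  have "computes X (PMu p) z (LEAST y. P X z y)" if X: "X \<in> K" for X z
  proof -
    obtain y where "P X z y" using ex[OF X] by blast
    moreover have "computes X p (prod_encode (z, k)) (of_bool (\<not> P X z k))" for k
      using p[rule_format, OF X, of "prod_encode (z, k)"] by simp
    ultimately show ?thesis by (intro computes_mu)
  qed
  then show ?thesis unfolding computable_def by blast
qed

text \<open>Minimization recovers a total function from its graph, which is often the easier object:
  below, the graph of division needs only multiplication and comparison.\<close>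

lemma computable_graph:
  assumes "decidable K (\<lambda>X w. psnd w = f X (pfst w))"
  shows "computable K f"
proof -
  have "computable K (\<lambda>X z. LEAST y. y = f X z)"
    by (rule computable_Least[where P = "\<lambda>X z y. y = f X z"]) (use assms in auto)
  then show ?thesis by (rule computable_cong) (simp add: Least_equality)
qed

text \<open>The least \<open>y\<close> that is either at least the bound or a counterexample always exists, and it
  reaches the bound exactly if there is no counterexample.\<close>

lemma decidable_all_less:
  assumes t: "computable K t" and P: "decidable K (\<lambda>X w. P X (pfst w) (psnd w))"
  shows "decidable K (\<lambda>X z. \<forall>y<t X z. P X z y)"
proof -
  let ?Q = "\<lambda>X z y. t X z \<le> y \<or> \<not> P X z y"
  have ex: "\<exists>y. ?Q X z y" for X z by auto
  have "computable K (\<lambda>X z. LEAST y. ?Q X z y)"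
    by (rule computable_Least[where P = ?Q])
      (intro decidable_disj decidable_le decidable_not P computable_psnd computable_id
        computable_comp[OF t] computable_pfst ex)+
  then have "decidable K (\<lambda>X z. t X z \<le> (LEAST y. ?Q X z y))" by (intro decidable_le t)
  then show ?thesis
  proof (rule decidable_cong)
    fix X z
    show "t X z \<le> (LEAST y. ?Q X z y) \<longleftrightarrow> (\<forall>y<t X z. P X z y)"
      using LeastI_ex[OF ex[of X z]] not_less_Least[of _ "?Q X z"]
      by (meson le_less_trans linorder_not_less)
  qed
qed

lemma decidable_ex_less:
  assumes "computable K t" "decidable K (\<lambda>X w. P X (pfst w) (psnd w))"
  shows "decidable K (\<lambda>X z. \<exists>y<t X z. P X z y)"
proof -
  have "decidable K (\<lambda>X z. \<not> (\<forall>y<t X z. \<not> P X z y))"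
    using assms by (intro decidable_not decidable_all_less)
  then show ?thesis by simp
qed

lemma computable_div:
  assumes f: "computable K f" and g: "computable K g"
  shows "computable K (\<lambda>X z. f X z div g X z)"
proof (rule computable_graph)
  have *: "(q = a div b) = (b = 0 \<and> q = 0 \<or> 0 < b \<and> q * b \<le> a \<and> a < Suc q * b)" for q a b :: nat
  proof (cases "b = 0")
    case False
    then show ?thesis
      by (auto simp: mult.commute intro!: div_nat_eqI[symmetric]
          dest: dividend_less_times_div[of b a])
  qed simp
  show "decidable K (\<lambda>X w. psnd w = f X (pfst w) div g X (pfst w))"
    unfolding *
    by (intro decidable_disj decidable_conj decidable_eq decidable_le decidable_less computable_mult
        computable_Suc computable_psnd computable_id computable_const
        computable_comp[OF f] computable_comp[OF g] computable_pfst)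
qed

lemma computable_mod:
  assumes "computable K f" "computable K g"
  shows "computable K (\<lambda>X z. f X z mod g X z)"
  unfolding modulo_nat_def by (intro computable_diff computable_mult computable_div assms)

lemma decidable_set_decode:
  assumes "computable K f" "computable K g"
  shows "decidable K (\<lambda>X z. f X z \<in> set_decode (g X z))"
  unfolding set_decode_def mem_Collect_eq odd_iff_mod_2_eq_one
  by (intro decidable_eq computable_mod computable_div computable_power computable_const assms)

text \<open>The closure rules are syntax directed: for a function or relation written as a term in the
  input, they reduce computability to that of its atomic parts. A bound variable and the input are
  merged into one number, whence the projections in the rules for bounded quantifiers.\<close>

lemmas computable_intros =
  computable_const computable_id computable_Suc computable_pfst computable_psnd
  computable_pfst_id computable_psnd_id computable_pair
  computable_add computable_mult computable_power computable_diff computable_div computable_mod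
  computable_if
  decidable_const decidable_not decidable_conj decidable_disj decidable_imp decidable_iff
  decidable_le decidable_less decidable_eq decidable_all_less decidable_ex_less decidable_oracle
  decidable_set_decode

fun oracle_subst :: "prog \<Rightarrow> prog \<Rightarrow> prog" where
  "oracle_subst q POracle = q"
| "oracle_subst q (PPair a b) = PPair (oracle_subst q a) (oracle_subst q b)"
| "oracle_subst q (PComp a b) = PComp (oracle_subst q a) (oracle_subst q b)"
| "oracle_subst q (PPrec a b) = PPrec (oracle_subst q a) (oracle_subst q b)"
| "oracle_subst q (PMu a) = PMu (oracle_subst q a)"
| "oracle_subst q p = p"

lemma computes_oracle_subst:
  assumes q: "\<And>n. computes X q n (of_bool (n \<in> Y))"
  shows "computes Y p n m \<Longrightarrow> computes X (oracle_subst q p) n m"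
proof (induction rule: computes.induct)
  case (5 n)
  then show ?case using q[of n] by (simp add: of_bool_def)
next
  case (10 p a k)
  then show ?case by (auto intro: computes.intros)
qed (auto intro: computes.intros)

lemma computable_subst:
  assumes "decidable K (\<lambda>X n. n \<in> Y)" "computable {Y} f"
  shows "computable K (\<lambda>_. f Y)"
proof -
  obtain q where "\<forall>X\<in>K. \<forall>n. computes X q n (of_bool (n \<in> Y))"
    using assms(1) unfolding decidable_def computable_def by blast
  then show ?thesis
    using assms(2) computes_oracle_subst unfolding computable_def by blast
qed

lemma decidable_subst:
  assumes "decidable K (\<lambda>X n. n \<in> Y)" "decidable {Y} P"
  shows "decidable K (\<lambda>_. P Y)"
  using computable_subst[OF assms(1), of "\<lambda>X n. of_bool (P X n)"] assms(2)
  by (simp add: decidable_def)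

lemma turing_le_trans: "X \<le>\<^sub>T Y \<Longrightarrow> Y \<le>\<^sub>T Z \<Longrightarrow> X \<le>\<^sub>T Z"
  unfolding turing_le_iff_decidable by (rule decidable_subst[of "{Z}" Y "\<lambda>_ n. n \<in> X"])

lemma computes_deterministic: "computes X p n m \<Longrightarrow> computes X p n m' \<Longrightarrow> m = m'"
proof (induction arbitrary: m' rule: computes.induct)
  case (1 n)
  from 1 show ?case by cases simp
next
  case (2 n)
  from 2 show ?case by cases simp
next
  case (3 a b)
  then show ?case by cases simp
next
  case (4 a b)
  then show ?case by cases simp
next
  case (5 n)
  from 5 show ?case by cases simp
next
  case (6 p n a q b)
  from 6(5) show ?case by cases (metis 6(3,4))
next
  case (7 q n k p m)
  from 7(5) show ?case by cases (metis 7(3,4))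
next
  case (8 p a m q)
  from 8(3) show ?case by cases (use 8(2) in simp_all)
next
  case (9 p q a k r m)
  from 9(5) show ?case
    by cases (simp, metis 9(3,4) prod_encode_eq prod.inject Suc_inject)
next
  case (10 p a k)
  from 10(4) have m': "computes X p (prod_encode (a, m')) 0"
    "\<forall>j<m'. \<exists>r. computes X p (prod_encode (a, j)) (Suc r)"
    by (cases; simp)+
  have False if "k < m'" using that 10(2) m'(2) by (metis nat.distinct(1))
  moreover have False if "m' < k" using that 10(3) m'(1) by (metis nat.distinct(1))
  ultimately show ?case by (meson linorder_neqE_nat)
qed

section \<open>Certificates of computations\<close>

text \<open>A computation is certified by a finite set of triples \<open>(e, n, m)\<close>, read as: the program with
  index \<open>e\<close> maps \<open>n\<close> to \<open>m\<close>. It suffices that every triple follows from other triples of the set by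
  one rule of \<open>computes\<close>: each rule reduces a program to its subprograms, or a recursion to a
  smaller recursion argument, so that circular justifications are impossible.\<close>

abbreviation triple :: "nat \<Rightarrow> nat \<Rightarrow> nat \<Rightarrow> nat" where
  "triple e n m \<equiv> prod_encode (e, prod_encode (n, m))"

lemma less_of_mem_set_decode: "z \<in> set_decode d \<Longrightarrow> z < d"
proof -
  assume z: "z \<in> set_decode d"
  then have "d \<noteq> 0" by (metis set_decode_zero empty_iff)
  have "2 ^ z \<le> d"
  proof (rule ccontr)
    assume "\<not> 2 ^ z \<le> d"
    then have "d div 2 ^ z = 0" by simp
    then show False using z by (simp add: set_decode_def)
  qed
  then show "z < d" using less_exp[of z] by linarith
qed

lemma triple_less:
  assumes "triple e n m \<in> set_decode d"
  shows "e < d" "n < d" "m < d"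
  using less_of_mem_set_decode[OF assms] le_prod_encode_1[of e "prod_encode (n, m)"]
    le_prod_encode_2[of "prod_encode (n, m)" e] le_prod_encode_1[of n m] le_prod_encode_2[of m n]
  by linarith+

text \<open>The residues modulo 4 separate the composite programs according to \<open>prog_index\<close>. The
  disjuncts are the rules of \<open>computes\<close>, with the components of pairs obtained by projections.\<close>

definition justified_line :: "nat set \<Rightarrow> nat set \<Rightarrow> nat \<Rightarrow> nat \<Rightarrow> nat \<Rightarrow> bool" where
  "justified_line X D e n m \<longleftrightarrow>
     e = 0 \<and> m = 0 \<or>
     e = 1 \<and> m = Suc n \<or>
     e = 2 \<and> m = pfst n \<or>
     e = 3 \<and> m = psnd n \<or>
     e = 4 \<and> (n \<in> X \<and> m = 1 \<or> n \<notin> X \<and> m = 0) \<or>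
     5 \<le> e \<and> e mod 4 = 1 \<and>
       (\<exists>a. triple (pfst ((e - 5) div 4)) n a \<in> D \<and>
         (\<exists>b. triple (psnd ((e - 5) div 4)) n b \<in> D \<and> m = prod_encode (a, b))) \<or>
     5 \<le> e \<and> e mod 4 = 2 \<and>
       (\<exists>k. triple (psnd ((e - 5) div 4)) n k \<in> D \<and> triple (pfst ((e - 5) div 4)) k m \<in> D) \<or>
     5 \<le> e \<and> e mod 4 = 3 \<and> psnd n = 0 \<and> triple (pfst ((e - 5) div 4)) (pfst n) m \<in> D \<or>
     5 \<le> e \<and> e mod 4 = 3 \<and> 0 < psnd n \<and>
       (\<exists>r. triple e (prod_encode (pfst n, psnd n - 1)) r \<in> D \<and>
         triple (psnd ((e - 5) div 4)) (prod_encode (pfst n, prod_encode (psnd n - 1, r))) m \<in> D) \<or>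
     5 \<le> e \<and> e mod 4 = 0 \<and> triple ((e - 8) div 4) (prod_encode (n, m)) 0 \<in> D \<and>
       (\<forall>j<m. \<exists>r. triple ((e - 8) div 4) (prod_encode (n, j)) (Suc r) \<in> D)"

definition derivation_set :: "nat set \<Rightarrow> nat set \<Rightarrow> bool" where
  "derivation_set X D \<longleftrightarrow> (\<forall>e n m. triple e n m \<in> D \<longrightarrow> justified_line X D e n m)"

lemma justified_line_mono:
  assumes "justified_line X D e n m" "D \<subseteq> D'"
  shows "justified_line X D' e n m"
proof -
  have D: "z \<in> D \<longrightarrow> z \<in> D'" for z using assms(2) by blast
  have "justified_line X D e n m \<longrightarrow> justified_line X D' e n m"
    unfolding justified_line_def
    by (intro D imp_refl disj_mono conj_mono ex_mono all_mono imp_mono)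
  with assms(1) show ?thesis by blast
qed

lemma derivation_set_Un:
  "derivation_set X D \<Longrightarrow> derivation_set X D' \<Longrightarrow> derivation_set X (D \<union> D')"
  unfolding derivation_set_def using justified_line_mono by (metis Un_iff Un_upper1 Un_upper2)

lemma derivation_set_insert:
  "derivation_set X D \<Longrightarrow> justified_line X D e n m \<Longrightarrow> derivation_set X (insert (triple e n m) D)"
  unfolding derivation_set_def using justified_line_mono
  by (metis insert_iff prod.inject prod_encode_eq subset_insertI)

lemma index_arith:
  "(5 + 4 * k) mod 4 = (1::nat)" "(6 + 4 * k) mod 4 = (2::nat)" "(7 + 4 * k) mod 4 = (3::nat)"
  "(8 + 4 * k) mod 4 = (0::nat)" "(5 + 4 * k - 5) div 4 = k" "(6 + 4 * k - 5) div 4 = k"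
  "(7 + 4 * k - 5) div 4 = k" "(8 + 4 * k - 8) div 4 = k"
  by presburger+

lemma justified_line_index:
  "justified_line X D (prog_index PZero) n m \<longleftrightarrow> m = 0"
  "justified_line X D (prog_index PSucc) n m \<longleftrightarrow> m = Suc n"
  "justified_line X D (prog_index PLeft) n m \<longleftrightarrow> m = pfst n"
  "justified_line X D (prog_index PRight) n m \<longleftrightarrow> m = psnd n"
  "justified_line X D (prog_index POracle) n m \<longleftrightarrow> m = of_bool (n \<in> X)"
  "justified_line X D (prog_index (PPair p q)) n m \<longleftrightarrow>
    (\<exists>a b. triple (prog_index p) n a \<in> D \<and> triple (prog_index q) n b \<in> D \<and> m = prod_encode (a, b))"
  "justified_line X D (prog_index (PComp p q)) n m \<longleftrightarrow>
    (\<exists>k. triple (prog_index q) n k \<in> D \<and> triple (prog_index p) k m \<in> D)"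
  "justified_line X D (prog_index (PPrec p q)) n m \<longleftrightarrow>
    psnd n = 0 \<and> triple (prog_index p) (pfst n) m \<in> D \<or>
    0 < psnd n \<and> (\<exists>r. triple (prog_index (PPrec p q)) (prod_encode (pfst n, psnd n - 1)) r \<in> D \<and>
         triple (prog_index q) (prod_encode (pfst n, prod_encode (psnd n - 1, r))) m \<in> D)"
  "justified_line X D (prog_index (PMu p)) n m \<longleftrightarrow>
    triple (prog_index p) (prod_encode (n, m)) 0 \<in> D \<and>
       (\<forall>j<m. \<exists>r. triple (prog_index p) (prod_encode (n, j)) (Suc r) \<in> D)"
  unfolding justified_line_def prog_index.simps index_arith
  by (auto simp del: prod_encode_def)

text \<open>Structural induction on the program, with an inner induction on the recursion argument for
  primitive recursion: this is the well-foundedness that replaces an order on the triples.\<close>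

lemma derivation_set_sound:
  assumes D: "derivation_set X D"
  shows "triple (prog_index p) n m \<in> D \<Longrightarrow> computes X p n m"
proof (induction p arbitrary: n m)
  case (PPair p q)
  then have "justified_line X D (prog_index (PPair p q)) n m" using D derivation_set_def by blast
  then show ?case unfolding justified_line_index using PPair.IH by (auto intro!: computes.intros(6))
next
  case (PComp p q)
  then have "justified_line X D (prog_index (PComp p q)) n m" using D derivation_set_def by blast
  then show ?case unfolding justified_line_index using PComp.IH by (blast intro: computes.intros(7))
next
  case (PPrec p q)
  have "triple (prog_index (PPrec p q)) (prod_encode (a, k)) m \<in> D
    \<Longrightarrow> computes X (PPrec p q) (prod_encode (a, k)) m" for a k m
  proof (induction k arbitrary: m)
    case 0
    then have "justified_line X D (prog_index (PPrec p q)) (prod_encode (a, 0)) m"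
      using D derivation_set_def by blast
    then show ?case unfolding justified_line_index using PPrec.IH by (auto intro!: computes.intros(8))
  next
    case (Suc k)
    then have "justified_line X D (prog_index (PPrec p q)) (prod_encode (a, Suc k)) m"
      using D derivation_set_def by blast
    then obtain r where "triple (prog_index (PPrec p q)) (prod_encode (a, k)) r \<in> D"
      "triple (prog_index q) (prod_encode (a, prod_encode (k, r))) m \<in> D"
      unfolding justified_line_index by auto
    then show ?case using Suc.IH PPrec.IH by (blast intro: computes.intros(9))
  qed
  then show ?case using PPrec.prems by (metis prod_encode_pfst_psnd)
next
  case (PMu p)
  then have "justified_line X D (prog_index (PMu p)) n m" using D derivation_set_def by blast
  then show ?case unfolding justified_line_index using PMu.IH by (intro computes.intros(10)) blast+
next
  case PZero
  then have "justified_line X D (prog_index PZero) n m" using D derivation_set_def by blast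
  then show ?case unfolding justified_line_index by (auto intro: computes.intros)
next
  case PSucc
  then have "justified_line X D (prog_index PSucc) n m" using D derivation_set_def by blast
  then show ?case unfolding justified_line_index by (auto intro: computes.intros)
next
  case PLeft
  then have "justified_line X D (prog_index PLeft) n m" using D derivation_set_def by blast
  then show ?case unfolding justified_line_index by (auto intro: computes_left)
next
  case PRight
  then have "justified_line X D (prog_index PRight) n m" using D derivation_set_def by blast
  then show ?case unfolding justified_line_index by (auto intro: computes_right)
next
  case POracle
  then have "justified_line X D (prog_index POracle) n m" using D derivation_set_def by blast
  then show ?case unfolding justified_line_index
    using computes.intros(5)[of X n] by (simp add: of_bool_def)
qed

definition derivable :: "nat set \<Rightarrow> prog \<Rightarrow> nat \<Rightarrow> nat \<Rightarrow> bool" where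
  "derivable X p n m \<longleftrightarrow>
    (\<exists>D. finite D \<and> derivation_set X D \<and> triple (prog_index p) n m \<in> D)"

lemma derivable_step:
  assumes "finite D" "derivation_set X D" "justified_line X D (prog_index p) n m"
  shows "derivable X p n m"
  unfolding derivable_def
  by (rule exI[of _ "insert (triple (prog_index p) n m) D"])
     (use assms in \<open>simp add: derivation_set_insert\<close>)

lemma derivable_axiom: "justified_line X {} (prog_index p) n m \<Longrightarrow> derivable X p n m"
  by (rule derivable_step[of "{}"]) (simp_all add: derivation_set_def)

lemma derivable_collect:
  assumes "finite I" "\<And>i. i \<in> I \<Longrightarrow> derivable X (p i) (n i) (m i)"
  shows "\<exists>D. finite D \<and> derivation_set X D \<and> (\<forall>i\<in>I. triple (prog_index (p i)) (n i) (m i) \<in> D)"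
  using assms
proof (induction I)
  case empty
  have "finite {} \<and> derivation_set X {}" by (simp add: derivation_set_def)
  then show ?case by blast
next
  case (insert i I)
  then obtain D where D: "finite D" "derivation_set X D"
    "\<forall>i\<in>I. triple (prog_index (p i)) (n i) (m i) \<in> D" by auto
  obtain D' where "finite D'" "derivation_set X D'" "triple (prog_index (p i)) (n i) (m i) \<in> D'"
    using insert.prems[of i] by (auto simp: derivable_def)
  with D show ?case by (intro exI[of _ "D \<union> D'"]) (auto simp: derivation_set_Un)
qed

lemma derivable_collect2:
  assumes "derivable X p n m" "derivable X p' n' m'"
  shows "\<exists>D. finite D \<and> derivation_set X D \<and> triple (prog_index p) n m \<in> D
    \<and> triple (prog_index p') n' m' \<in> D"
proof -
  obtain D D' where "finite D" "derivation_set X D" "triple (prog_index p) n m \<in> D"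
    "finite D'" "derivation_set X D'" "triple (prog_index p') n' m' \<in> D'"
    using assms by (auto simp: derivable_def)
  then show ?thesis by (intro exI[of _ "D \<union> D'"]) (auto simp: derivation_set_Un)
qed

lemma derivable_complete: "computes X p n m \<Longrightarrow> derivable X p n m"
proof (induction rule: computes.induct)
  case (6 p n a q b)
  from derivable_collect2[OF 6(3,4)] obtain D where D: "finite D" "derivation_set X D"
    "triple (prog_index p) n a \<in> D" "triple (prog_index q) n b \<in> D"
    by blast
  show ?case
    by (rule derivable_step[OF D(1,2)], unfold justified_line_index) (use D(3,4) in metis)
next
  case (7 q n k p m)
  from derivable_collect2[OF 7(3,4)] obtain D where D: "finite D" "derivation_set X D"
    "triple (prog_index q) n k \<in> D" "triple (prog_index p) k m \<in> D"
    by blast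
  show ?case
    by (rule derivable_step[OF D(1,2)], unfold justified_line_index) (use D(3,4) in metis)
next
  case (8 p a m q)
  then obtain D where D: "finite D" "derivation_set X D" "triple (prog_index p) a m \<in> D"
    by (auto simp: derivable_def)
  show ?case
    by (rule derivable_step[OF D(1,2)], unfold justified_line_index pfst_encode psnd_encode)
       (use D(3) in metis)
next
  case (9 p q a k r m)
  from derivable_collect2[OF 9(3,4)] obtain D where D: "finite D" "derivation_set X D"
    "triple (prog_index (PPrec p q)) (prod_encode (a, k)) r \<in> D"
    "triple (prog_index q) (prod_encode (a, prod_encode (k, r))) m \<in> D"
    by blast
  show ?case
    by (rule derivable_step[OF D(1,2)], unfold justified_line_index pfst_encode psnd_encode)
       (use D(3,4) in \<open>metis diff_Suc_1 zero_less_Suc\<close>)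
next
  case (10 p a k)
  from 10(3) obtain r where r: "\<And>j. j < k \<Longrightarrow> derivable X p (prod_encode (a, j)) (Suc (r j))" by metis
  have "derivable X p (prod_encode (a, j)) (if j < k then Suc (r j) else 0)" if "j \<in> {..k}" for j
    using r[of j] 10(2) that by (cases "j = k") auto
  from derivable_collect[of "{..k}" X "\<lambda>_. p" "\<lambda>j. prod_encode (a, j)"
      "\<lambda>j. if j < k then Suc (r j) else 0", OF finite_atMost this]
  obtain D where D: "finite D" "derivation_set X D"
    "\<forall>j\<in>{..k}. triple (prog_index p) (prod_encode (a, j)) (if j < k then Suc (r j) else 0) \<in> D"
    by blast
  show ?case
  proof (rule derivable_step[OF D(1,2)], unfold justified_line_index, intro conjI allI impI)
    show "triple (prog_index p) (prod_encode (a, k)) 0 \<in> D"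
      using D(3) by (metis atMost_iff order_refl less_irrefl)
    fix j assume "j < k"
    then show "\<exists>r. triple (prog_index p) (prod_encode (a, j)) (Suc r) \<in> D"
      using D(3) by (metis atMost_iff less_imp_le)
  qed
qed (rule derivable_axiom, simp only: justified_line_index of_bool_def pfst_encode psnd_encode)+

text \<open>The number \<open>d\<close>, read as the code of a finite set of triples, certifies that the program with
  index \<open>e\<close> halts on its own index.\<close>

definition halting_by :: "nat set \<Rightarrow> nat \<Rightarrow> nat \<Rightarrow> bool" where
  "halting_by X e d \<longleftrightarrow>
    derivation_set X (set_decode d) \<and> (\<exists>m. triple e e m \<in> set_decode d)"

lemma mem_jump_iff: "e \<in> jump X \<longleftrightarrow> (\<exists>d. halting_by X e d)"
proof
  assume "e \<in> jump X"
  then obtain p m where "e = prog_index p" "computes X p e m" by (auto simp: jump_def)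
  then obtain D where "finite D" "derivation_set X D" "triple e e m \<in> D"
    using derivable_complete unfolding derivable_def by blast
  then have "halting_by X e (set_encode D)" unfolding halting_by_def by (auto simp: set_encode_inverse)
  then show "\<exists>d. halting_by X e d" ..
next
  assume "\<exists>d. halting_by X e d"
  then obtain d m where "derivation_set X (set_decode d)" "triple e e m \<in> set_decode d"
    by (auto simp: halting_by_def)
  moreover obtain p where "e = prog_index p" using bij_prog_index by (metis bij_pointE)
  ultimately show "e \<in> jump X" unfolding jump_def using derivation_set_sound by blast
qed

text \<open>The use principle: all triples in the set coded by \<open>d\<close>, and hence all oracle queries mentioned
  there, are below \<open>d\<close>.\<close>

lemma halting_by_use:
  assumes "halting_by X e d" "\<And>n. n < d \<Longrightarrow> n \<in> X \<longleftrightarrow> n \<in> Y"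
  shows "halting_by Y e d"
proof -
  have "justified_line Y (set_decode d) e n m"
    if "justified_line X (set_decode d) e n m" "n < d" for e n m
    using that assms(2)[OF that(2)] unfolding justified_line_def by metis
  then show ?thesis
    using assms(1) triple_less(2) unfolding halting_by_def derivation_set_def by blast
qed

text \<open>The parameter \<open>Q\<close> allows the oracle of the certified computation to be the actual oracle or a
  finite set given by its code. Every unbounded quantifier is bounded by the code \<open>d\<close>.\<close>

lemma decidable_justified_line:
  assumes Q: "decidable K (\<lambda>X w. pfst w \<in> Q X (psnd w))"
    and "computable K q" "computable K d" "computable K e" "computable K n" "computable K m"
  shows "decidable K (\<lambda>X z.
    justified_line (Q X (q X z)) (set_decode (d X z)) (e X z) (n X z) (m X z))"
proof -
  have b: "(\<exists>a. triple i n a \<in> set_decode d \<and> P a) \<longleftrightarrow> (\<exists>a<d. triple i n a \<in> set_decode d \<and> P a)"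
    for i n d P using triple_less by blast
  have b': "(\<exists>a. triple i n (Suc a) \<in> set_decode d) \<longleftrightarrow> (\<exists>a<d. triple i n (Suc a) \<in> set_decode d)"
    for i n d using triple_less Suc_lessD by blast
  have Q': "decidable K (\<lambda>X z. f X z \<in> Q X (g X z))"
    if "computable K f" "computable K g" for f g
    using decidable_comp[OF Q computable_pair[OF that]] by simp
  have at: "computable K (\<lambda>X z. q X (f X z))" "computable K (\<lambda>X z. d X (f X z))"
    "computable K (\<lambda>X z. e X (f X z))" "computable K (\<lambda>X z. n X (f X z))"
    "computable K (\<lambda>X z. m X (f X z))"
    if "computable K f" for f
    using computable_comp[OF _ that] assms(2-) by blast+
  show ?thesis
    unfolding justified_line_def b b'
    by (intro computable_intros Q' at assms(2-))
qed

lemma decidable_halting_by: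
  assumes Q: "decidable K (\<lambda>X w. pfst w \<in> Q X (psnd w))"
    and "computable K q" "computable K e" "computable K d"
  shows "decidable K (\<lambda>X z. halting_by (Q X (q X z)) (e X z) (d X z))"
proof -
  have 1: "derivation_set Y (set_decode d) \<longleftrightarrow>
      (\<forall>e<d. \<forall>n<d. \<forall>m<d. triple e n m \<in> set_decode d \<longrightarrow> justified_line Y (set_decode d) e n m)"
    and 2: "(\<exists>m. triple e e m \<in> set_decode d) \<longleftrightarrow> (\<exists>m<d. triple e e m \<in> set_decode d)"
    for Y d e
    unfolding derivation_set_def using triple_less by blast+
  have at: "computable K (\<lambda>X z. q X (f X z))" "computable K (\<lambda>X z. d X (f X z))"
    "computable K (\<lambda>X z. e X (f X z))"
    if "computable K f" for f
    using computable_comp[OF _ that] assms(2-) by blast+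
  show ?thesis
    unfolding halting_by_def 1 2
    by (intro decidable_justified_line[OF Q] computable_intros at assms(2-))
qed

section \<open>The Turing jump\<close>

lemma mem_jump_prog_index:
  "prog_index p \<in> jump X \<longleftrightarrow> (\<exists>m. computes X p (prog_index p) m)"
  unfolding jump_def using bij_prog_index by (auto dest: bij_is_inj injD simp del: prog_index.simps)

text \<open>For a semidecidable relation, the search for a witness with the parameter \<open>z\<close> hard-wired as a
  constant program ignores its input; so it halts on its own index exactly if a witness exists. The
  index is computable from \<open>z\<close>, without oracle, because the index of a constant program is obtained
  by primitive recursion.\<close>

lemma ce_index:
  assumes R: "decidable K (\<lambda>X w. R X (pfst w) (psnd w))"
  shows "\<exists>f. (\<forall>L. computable L (\<lambda>_. f)) \<and>
    (\<forall>X\<in>K. \<forall>z. f z \<in> jump X \<longleftrightarrow> (\<exists>y. R X z y))"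
proof -
  obtain r where r: "\<And>X w. X \<in> K \<Longrightarrow> computes X r w (of_bool (\<not> R X (pfst w) (psnd w)))"
    using decidable_not[OF R] unfolding decidable_def computable_def by blast
  define search where "search z = PComp (PMu r) (pconst z)" for z
  have halts: "(\<exists>m. computes X (search z) n m) \<longleftrightarrow> (\<exists>y. R X z y)" if X: "X \<in> K" for X z n
  proof
    assume "\<exists>m. computes X (search z) n m"
    then obtain m k where "computes X (pconst z) n k" and mu: "computes X (PMu r) k m"
      unfolding search_def by (blast elim: computes.cases)
    then have "k = z" using computes_deterministic computes_pconst by blast
    from mu have "computes X r (prod_encode (k, m)) 0" by cases
    then have "of_bool (\<not> R X k m) = (0::nat)"
      using computes_deterministic r[OF X, of "prod_encode (k, m)"] by fastforce
    with \<open>k = z\<close> show "\<exists>y. R X z y" by (auto split: if_splits)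
  next
    assume "\<exists>y. R X z y"
    then obtain y where "R X z y" ..
    moreover have "computes X r (prod_encode (z, k)) (of_bool (\<not> R X z k))" for k
      using r[OF X, of "prod_encode (z, k)"] by simp
    ultimately have "computes X (PMu r) z (LEAST k. R X z k)" by (rule computes_mu[rotated])
    then show "\<exists>m. computes X (search z) n m"
      unfolding search_def using computes_pconst computes.intros(7) by blast
  qed
  show ?thesis
  proof (intro exI[of _ "\<lambda>z. prog_index (search z)"] conjI allI ballI)
    show "prog_index (search z) \<in> jump X \<longleftrightarrow> (\<exists>y. R X z y)" if "X \<in> K" for X z
      using halts[OF that] mem_jump_prog_index by simp
    have "prog_index (pconst z) = rec_nat 0 (\<lambda>_ i. 6 + 4 * prod_encode (1, i)) z" for z
      by (induction z) auto
    moreover have "computable L (\<lambda>_ z. rec_nat 0 (\<lambda>_ i. 6 + 4 * prod_encode (1, i)) z)" for L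
      by (rule computable_prec[where s = "\<lambda>_ _ _ i. 6 + 4 * prod_encode (1, i)"])
         (intro computable_intros)+
    ultimately show "computable L (\<lambda>_ z. prog_index (search z))" for L
      unfolding search_def by (simp del: pconst.simps) (intro computable_intros)
  qed
qed

lemma decidable_ce_jump:
  assumes R: "decidable {X} (\<lambda>X w. R X (pfst w) (psnd w))"
  shows "decidable {jump X} (\<lambda>_ z. \<exists>y. R X z y)"
proof -
  obtain f where f: "\<forall>L. computable L (\<lambda>_. f)"
    "\<forall>Y\<in>{X}. \<forall>z. f z \<in> jump Y \<longleftrightarrow> (\<exists>y. R Y z y)"
    using ce_index[OF R] by (elim exE conjE)
  from decidable_oracle[OF spec[OF f(1)]] show ?thesis by (rule decidable_cong) (simp add: f(2))
qed

lemma decidable_halting_by_oracle: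
  "decidable K (\<lambda>X w. halting_by X (pfst w) (psnd w))"
  by (rule decidable_halting_by[where Q = "\<lambda>X _. X" and q = "\<lambda>_ z. z"])
     (intro computable_intros)+

lemma jump_mono:
  assumes "Y \<le>\<^sub>T X"
  shows "jump Y \<le>\<^sub>T jump X"
proof -
  have "decidable {X} (\<lambda>_ w. halting_by Y (pfst w) (psnd w))"
    using assms decidable_halting_by_oracle unfolding turing_le_iff_decidable
    by (rule decidable_subst)
  from decidable_ce_jump[OF this] show ?thesis
    unfolding turing_le_iff_decidable mem_jump_iff .
qed

lemma low_mono: "low X \<Longrightarrow> Y \<le>\<^sub>T X \<Longrightarrow> low Y"
  unfolding low_def using jump_mono turing_le_trans by blast

text \<open>The diagonal argument: from a decision procedure for the jump one builds a program that halts
  on its own index exactly if it does not.\<close>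

lemma jump_not_turing_le: "\<not> jump X \<le>\<^sub>T X"
proof
  assume "jump X \<le>\<^sub>T X"
  then have "decidable {X} (\<lambda>_ w. pfst w \<in> jump X)"
    unfolding turing_le_iff_decidable by (rule decidable_comp) (intro computable_intros)
  then obtain p where p: "\<And>w. computes X p w (of_bool (pfst w \<in> jump X))"
    unfolding decidable_def computable_def by blast
  let ?e = "prog_index (PMu p)"
  have *: "computes X p (prod_encode (?e, k)) (of_bool (?e \<in> jump X))" for k
    using p[of "prod_encode (?e, k)"] by (simp del: prog_index.simps)
  have self: "?e \<in> jump X \<longleftrightarrow> (\<exists>m. computes X (PMu p) ?e m)"
    by (rule mem_jump_prog_index)
  show False
  proof (cases "?e \<in> jump X")
    case True
    then obtain m where "computes X (PMu p) ?e m" using self by blast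
    then have "computes X p (prod_encode (?e, m)) 0" by cases
    then show False using computes_deterministic[OF *] True by fastforce
  next
    case False
    then have "computes X (PMu p) ?e (LEAST k::nat. True)"
      using * by (intro computes_mu[where P = "\<lambda>_. True"]) auto
    then show False using self False by blast
  qed
qed

lemma mem_jump_use:
  assumes "halting_by X e d" "\<And>n. n < d \<Longrightarrow> n \<in> X \<longleftrightarrow> n \<in> Y"
  shows "e \<in> jump Y"
  using halting_by_use[OF assms] mem_jump_iff by blast

section \<open>A low generic set\<close>

text \<open>A condition \<open>s\<close> is a pair \<open>(c, u)\<close>; it describes the sets that agree below \<open>u\<close> with the finite
  set coded by \<open>c\<close>. A number \<open>z = (c', d)\<close> describes an extension that makes the program \<open>e\<close> halt on
  its own index, where \<open>d\<close> is both the certificate and a bound on the use.\<close>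

definition forces_halt :: "nat \<Rightarrow> nat \<Rightarrow> nat \<Rightarrow> bool" where
  "forces_halt s e z \<longleftrightarrow>
     (\<forall>n<psnd s. n \<in> set_decode (pfst z) \<longleftrightarrow> n \<in> set_decode (pfst s)) \<and>
     halting_by (set_decode (pfst z)) e (psnd z)"

text \<open>The new bound covers the use of the halting computation, so that later stages preserve it. If no
  extension makes the program halt, then the condition already prevents it from halting.\<close>

primrec stage :: "nat \<Rightarrow> nat" where
  "stage 0 = 0"
| "stage (Suc e) =
    (if \<exists>z. forces_halt (stage e) e z
     then let z = LEAST z. forces_halt (stage e) e z in prod_encode (pfst z, psnd (stage e) + psnd z)
     else stage e)"

definition generic :: "nat set" where
  "generic = {n. \<exists>e. n < psnd (stage e) \<and> n \<in> set_decode (pfst (stage e))}"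

lemma stage_Suc_extends:
  "psnd (stage e) \<le> psnd (stage (Suc e))"
  "n < psnd (stage e) \<Longrightarrow>
    n \<in> set_decode (pfst (stage (Suc e))) \<longleftrightarrow> n \<in> set_decode (pfst (stage e))"
proof -
  have *: "psnd (stage e) \<le> psnd (stage (Suc e)) \<and> (\<forall>n<psnd (stage e).
    n \<in> set_decode (pfst (stage (Suc e))) \<longleftrightarrow> n \<in> set_decode (pfst (stage e)))"
  proof (cases "\<exists>z. forces_halt (stage e) e z")
    case True
    define z where "z = (LEAST z. forces_halt (stage e) e z)"
    have "forces_halt (stage e) e z" unfolding z_def using True by (rule LeastI_ex)
    moreover have "stage (Suc e) = prod_encode (pfst z, psnd (stage e) + psnd z)"
      using True by (simp add: z_def Let_def)
    ultimately show ?thesis by (simp add: forces_halt_def del: stage.simps)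
  qed simp
  from * show "psnd (stage e) \<le> psnd (stage (Suc e))" by blast
  from * show "n < psnd (stage e) \<Longrightarrow>
    n \<in> set_decode (pfst (stage (Suc e))) \<longleftrightarrow> n \<in> set_decode (pfst (stage e))" by blast
qed

lemma stage_extends:
  assumes "e \<le> f"
  shows "psnd (stage e) \<le> psnd (stage f)
    \<and> (\<forall>n<psnd (stage e). n \<in> set_decode (pfst (stage f)) \<longleftrightarrow> n \<in> set_decode (pfst (stage e)))"
  using assms
proof (induction f rule: dec_induct)
  case (step f)
  show ?case
  proof (intro conjI allI impI)
    show "psnd (stage e) \<le> psnd (stage (Suc f))"
      using step.IH stage_Suc_extends(1)[of f] by (meson le_trans)
    fix n assume n: "n < psnd (stage e)"
    then have "n < psnd (stage f)" using step.IH by (meson order_less_le_trans)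
    from stage_Suc_extends(2)[OF this] step.IH n
    show "n \<in> set_decode (pfst (stage (Suc f))) \<longleftrightarrow> n \<in> set_decode (pfst (stage e))" by blast
  qed
qed simp

lemma generic_stage:
  assumes "n < psnd (stage e)"
  shows "n \<in> generic \<longleftrightarrow> n \<in> set_decode (pfst (stage e))"
proof -
  have "n \<in> set_decode (pfst (stage e)) \<longleftrightarrow> n \<in> set_decode (pfst (stage f))"
    if "n < psnd (stage f)" for f
    using stage_extends[of e f] stage_extends[of f e] assms that by (metis nat_le_linear)
  then show ?thesis using assms unfolding generic_def by blast
qed

text \<open>If any set that satisfies the condition makes the program halt, then by the use principle a
  finite set does, namely a long enough initial part of it.\<close>

lemma forces_halt_exists:
  assumes "e \<in> jump H" "\<And>n. n < psnd s \<Longrightarrow> n \<in> H \<longleftrightarrow> n \<in> set_decode (pfst s)"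
  shows "\<exists>z. forces_halt s e z"
proof -
  obtain d where d: "halting_by H e d" using assms(1) mem_jump_iff by blast
  (* F has to fix enough of H both for the certificate and for the condition. *)
  define F where "F = H \<inter> {..<d + psnd s}"
  have F: "set_decode (set_encode F) = F" by (simp add: F_def set_encode_inverse)
  have "halting_by F e d" by (rule halting_by_use[OF d]) (simp add: F_def)
  then have "forces_halt s e (prod_encode (set_encode F, d))"
    unfolding forces_halt_def pfst_encode psnd_encode F using assms(2) by (simp add: F_def)
  then show ?thesis ..
qed

lemma mem_jump_generic_iff: "e \<in> jump generic \<longleftrightarrow> (\<exists>z. forces_halt (stage e) e z)"
proof
  assume "e \<in> jump generic"
  then show "\<exists>z. forces_halt (stage e) e z"
    by (rule forces_halt_exists) (rule generic_stage)
next
  assume ex: "\<exists>z. forces_halt (stage e) e z"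
  define z where "z = (LEAST z. forces_halt (stage e) e z)"
  have z: "forces_halt (stage e) e z" unfolding z_def using ex by (rule LeastI_ex)
  have "stage (Suc e) = prod_encode (pfst z, psnd (stage e) + psnd z)"
    using ex by (simp add: z_def Let_def)
  then have "n \<in> set_decode (pfst z) \<longleftrightarrow> n \<in> generic" if "n < psnd z" for n
    using generic_stage[of n "Suc e"] that by simp
  then show "e \<in> jump generic" using z mem_jump_use unfolding forces_halt_def by blast
qed

text \<open>Genericity: a program that does not halt relative to \<open>generic\<close> is prevented from halting by a
  finite part. Arbitrary oracles are admitted as extensions of this part.\<close>

lemma generic_decides:
  assumes "e \<notin> jump generic"
  obtains u where "\<And>H. (\<And>n. n < u \<Longrightarrow> n \<in> H \<longleftrightarrow> n \<in> generic) \<Longrightarrow> e \<notin> jump H"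
proof
  fix H assume "\<And>n. n < psnd (stage e) \<Longrightarrow> n \<in> H \<longleftrightarrow> n \<in> generic"
  then show "e \<notin> jump H"
    using assms forces_halt_exists[of e H "stage e"] generic_stage mem_jump_generic_iff by blast
qed

lemma decidable_forces_halt:
  assumes "computable K s" "computable K e" "computable K z"
  shows "decidable K (\<lambda>X w. forces_halt (s X w) (e X w) (z X w))"
proof -
  have at: "computable K (\<lambda>X w. s X (f X w))" "computable K (\<lambda>X w. z X (f X w))"
    if "computable K f" for f
    using computable_comp[OF _ that] assms by blast+
  show ?thesis
    unfolding forces_halt_def
    by (intro decidable_halting_by[where Q = "\<lambda>_. set_decode"] computable_intros at assms)
qed

text \<open>The question whether an extension makes the next program halt is semidecidable without oracle,
  hence decidable from the halting problem. So the halting problem computes the sequence of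
  conditions, and the answers to these questions are the jump of \<open>generic\<close>.\<close>

lemma low_generic: "low generic"
proof -
  let ?K = "{jump {}}"
  have Q: "decidable ?K (\<lambda>_ w. \<exists>z. forces_halt (pfst w) (psnd w) z)"
    by (rule decidable_ce_jump[where R = "\<lambda>_ w z. forces_halt (pfst w) (psnd w) z"])
       (intro decidable_forces_halt computable_intros)
  define step where "step e s = (if \<exists>z. forces_halt s e z
    then prod_encode (pfst (LEAST z. forces_halt s e z), psnd s + psnd (LEAST z. forces_halt s e z))
    else s)" for e s
  (* Without the first disjunct the search would diverge when no extension exists. *)
  let ?R = "\<lambda>_ w z. \<not> (\<exists>z. forces_halt (pfst w) (psnd w) z) \<or> forces_halt (pfst w) (psnd w) z"
  have "computable ?K (\<lambda>X w. LEAST z. ?R X w z)"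
  proof (rule computable_Least)
    show "decidable ?K (\<lambda>X w. ?R X (pfst w) (psnd w))"
      by (intro decidable_disj decidable_not decidable_comp[OF Q] decidable_forces_halt computable_intros)
  qed blast
  then have L: "computable ?K (\<lambda>_ w. LEAST z. ?R X w z)" for X by simp
  have L': "computable ?K (\<lambda>X w. (\<lambda>w. LEAST z. ?R X w z) (prod_encode (s X w, e X w)))"
    if "computable ?K s" "computable ?K e" for s e
    using computable_comp[OF L computable_pair[OF that]] by simp
  have Q': "decidable ?K (\<lambda>X w. \<exists>z. forces_halt (s X w) (e X w) z)"
    if "computable ?K s" "computable ?K e" for s e
    using decidable_comp[OF Q computable_pair[OF that]] by simp
  have step_alt: "step e s = (let z = LEAST z. ?R X (prod_encode (s, e)) z in
      if \<exists>z. forces_halt s e z then prod_encode (pfst z, psnd s + psnd z) else s)" for e s X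
  proof -
    have "(LEAST z. ?R X (prod_encode (s, e)) z) = (LEAST z. forces_halt s e z)"
      if "\<exists>z. forces_halt s e z"
      by (rule arg_cong[where f = Least]) (use that in auto)
    then show ?thesis unfolding step_def Let_def by presburger
  qed
  have "computable ?K (\<lambda>X e. rec_nat 0 step e)"
  proof (rule computable_prec[where s = "\<lambda>_ _. step"])
    show "computable ?K (\<lambda>X w. step (pfst (psnd w)) (psnd (psnd w)))"
      unfolding step_alt Let_def
      by (intro computable_intros Q' L')
  qed (intro computable_intros)+
  moreover have "stage e = rec_nat 0 step e" for e
    by (induction e) (simp_all add: step_def Let_def)
  ultimately have stage: "computable ?K (\<lambda>X e. stage e)" by simp
  have "decidable ?K (\<lambda>X e. \<exists>z. forces_halt (stage e) e z)"
    by (intro Q' stage computable_intros)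
  then show ?thesis
    unfolding low_def turing_le_iff_decidable mem_jump_generic_iff .
qed

section \<open>Turing ideals are models of recursive comprehension\<close>

lemma sat_set_cong:
  "(\<And>Z. Z \<in> free_set_vars \<phi> \<Longrightarrow> E Z = E' Z) \<Longrightarrow> sat M e E \<phi> \<longleftrightarrow> sat M e E' \<phi>"
proof (induction \<phi> arbitrary: e E E')
  case (AllS X \<phi>)
  then have "sat M e (E(X := A)) \<phi> \<longleftrightarrow> sat M e (E'(X := A)) \<phi>" for A
    by (intro AllS.IH) auto
  then show ?case by simp
next
  case (ExS X \<phi>)
  then have "sat M e (E(X := A)) \<phi> \<longleftrightarrow> sat M e (E'(X := A)) \<phi>" for A
    by (intro ExS.IH) auto
  then show ?case by simp
next
  case (Conj \<phi> \<psi>)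
  from Conj.IH(1)[of E E' e] Conj.IH(2)[of E E' e] Conj.prems show ?case by auto
next
  case (Disj \<phi> \<psi>)
  from Disj.IH(1)[of E E' e] Disj.IH(2)[of E E' e] Disj.prems show ?case by auto
next
  case (Imp \<phi> \<psi>)
  from Imp.IH(1)[of E E' e] Imp.IH(2)[of E E' e] Imp.prems show ?case by auto
next
  case (Iff \<phi> \<psi>)
  from Iff.IH(1)[of E E' e] Iff.IH(2)[of E E' e] Iff.prems show ?case by auto
next
  case (Neg \<phi>)
  from Neg.IH[of E E' e] Neg.prems show ?case by auto
next
  case (AllN x \<phi>)
  have "sat M f E \<phi> \<longleftrightarrow> sat M f E' \<phi>" for f
    using AllN.prems by (intro AllN.IH) auto
  then show ?case by simp
next
  case (ExN x \<phi>)
  have "sat M f E \<phi> \<longleftrightarrow> sat M f E' \<phi>" for f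
    using ExN.prems by (intro ExN.IH) auto
  then show ?case by simp
qed simp_all

lemma finite_free_set_vars: "finite (free_set_vars \<phi>)"
  by (induction \<phi>) auto

lemma computable_tm_val:
  assumes "\<And>x. computable K (env x)"
  shows "computable K (\<lambda>X z. tm_val (omega S) (\<lambda>x. env x X z) t)"
  by (induction t) (simp_all, (intro computable_intros assms; assumption)+)

text \<open>Each number variable is interpreted by a computable function of the input \<open>z\<close>, rather than by a
  component of a coded environment. A bounded quantifier then extends the input by the bound value,
  and the induction hypothesis is applied to the modified interpretation.\<close>

lemma decidable_bounded_form:
  assumes "bounded_form \<theta>"
    and "\<And>Z. Z \<in> free_set_vars \<theta> \<Longrightarrow> decidable K (\<lambda>_ n. n \<in> E Z)"
    and "\<And>x. computable K (env x)"
  shows "decidable K (\<lambda>X z. sat (omega S) (\<lambda>x. env x X z) E \<theta>)"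
  using assms
proof (induction arbitrary: env rule: bounded_form.induct)
  case (1 s t)
  then show ?case by (simp, intro decidable_eq computable_tm_val)
next
  case (2 s t)
  then show ?case by (simp, intro decidable_less computable_tm_val)
next
  case (3 t Z)
  have "decidable K (\<lambda>_ n. n \<in> E Z)" using 3 by simp
  from decidable_comp[OF this computable_tm_val[OF 3(2)]] show ?case by simp
next
  case (4 \<phi>)
  then show ?case by (simp, intro decidable_not) simp
next
  case (5 \<phi> \<psi>)
  then show ?case by (simp, intro decidable_conj) simp_all
next
  case (6 \<phi> \<psi>)
  then show ?case by (simp, intro decidable_disj) simp_all
next
  case (7 \<phi> \<psi>)
  then show ?case by (simp, intro decidable_imp) simp_all
next
  case (8 \<phi> \<psi>)
  then show ?case by (simp, intro decidable_iff) simp_all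
next
  case (9 \<phi> x t)
  let ?env = "\<lambda>y X w. if y = x then psnd w else env y X (pfst w)"
  have "computable K (?env y)" for y
    by (cases "y = x") (simp_all, intro computable_intros,
      intro computable_comp[OF 9(5)] computable_intros)
  then have IH: "decidable K (\<lambda>X w. sat (omega S) (\<lambda>y. ?env y X w) E \<phi>)"
    using 9 by (intro 9(3)) auto
  have env: "(\<lambda>y. ?env y X w) = (\<lambda>y. env y X (pfst w))(x := psnd w)" for X w by auto
  from IH[unfolded env] have "decidable K (\<lambda>X z. \<forall>a<tm_val (omega S) (\<lambda>y. env y X z) t.
      sat (omega S) ((\<lambda>y. env y X z)(x := a)) E \<phi>)"
    by (rule decidable_all_less[OF computable_tm_val[OF 9(5)]])
  moreover have "tm_val (omega S) (f(x := a)) t = tm_val (omega S) f t" for f a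
    using 9(2) by (intro tm_val_cong) auto
  ultimately show ?case by simp
next
  case (10 \<phi> x t)
  let ?env = "\<lambda>y X w. if y = x then psnd w else env y X (pfst w)"
  have "computable K (?env y)" for y
    by (cases "y = x") (simp_all, intro computable_intros,
      intro computable_comp[OF 10(5)] computable_intros)
  then have IH: "decidable K (\<lambda>X w. sat (omega S) (\<lambda>y. ?env y X w) E \<phi>)"
    using 10 by (intro 10(3)) auto
  have env: "(\<lambda>y. ?env y X w) = (\<lambda>y. env y X (pfst w))(x := psnd w)" for X w by auto
  from IH[unfolded env] have "decidable K (\<lambda>X z. \<exists>a<tm_val (omega S) (\<lambda>y. env y X z) t.
      sat (omega S) ((\<lambda>y. env y X z)(x := a)) E \<phi>)"
    by (rule decidable_ex_less[OF computable_tm_val[OF 10(5)]])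
  moreover have "tm_val (omega S) (f(x := a)) t = tm_val (omega S) f t" for f a
    using 10(2) by (intro tm_val_cong) auto
  ultimately show ?case by simp
qed

text \<open>Directedness expresses closure under joins: for downward closed classes the two are
  equivalent.\<close>

definition turing_ideal :: "nat set set \<Rightarrow> bool" where
  "turing_ideal S \<longleftrightarrow> S \<noteq> {} \<and> (\<forall>X\<in>S. \<forall>Y. Y \<le>\<^sub>T X \<longrightarrow> Y \<in> S) \<and>
    (\<forall>X\<in>S. \<forall>Y\<in>S. \<exists>Z\<in>S. X \<le>\<^sub>T Z \<and> Y \<le>\<^sub>T Z)"

lemma turing_ideal_finite_bound:
  assumes S: "turing_ideal S" and "finite I" "\<And>i. i \<in> I \<Longrightarrow> E i \<in> S"
  shows "\<exists>Z\<in>S. \<forall>i\<in>I. E i \<le>\<^sub>T Z"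
  using assms(2,3)
proof (induction I)
  case empty
  then show ?case using S by (auto simp: turing_ideal_def)
next
  case (insert i I)
  then obtain Z where Z: "Z \<in> S" "\<forall>i\<in>I. E i \<le>\<^sub>T Z" by auto
  obtain W where "W \<in> S" "Z \<le>\<^sub>T W" "E i \<le>\<^sub>T W"
    using S Z(1) insert.prems[of i] unfolding turing_ideal_def by blast
  then show ?case using Z(2) turing_le_trans by blast
qed

text \<open>For each \<open>a\<close>, either the existential formula has a witness or the universal one has a
  counterexample; both can be recognized from one set of the ideal that computes the finitely many
  set parameters, and searching for whichever comes first decides membership.\<close>

lemma sat_delta_set_mem:
  assumes S: "turing_ideal S" and E: "\<And>X. E X \<in> S"
    and \<phi>: "\<phi> \<in> Sigma01" and \<psi>: "\<psi> \<in> Pi01"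
    and eq: "\<And>a. sat (omega S) (e(x := a)) E \<phi> \<longleftrightarrow> sat (omega S) (e(x := a)) E \<psi>"
  shows "{a. sat (omega S) (e(x := a)) E \<phi>} \<in> S"
proof -
  obtain y \<theta> where \<theta>: "\<phi> = ExN y \<theta>" "bounded_form \<theta>" using \<phi> unfolding Sigma01_def by blast
  obtain y' \<theta>' where \<theta>': "\<psi> = AllN y' \<theta>'" "bounded_form \<theta>'" using \<psi> unfolding Pi01_def by blast
  obtain Z where Z: "Z \<in> S" "\<forall>V\<in>free_set_vars \<theta> \<union> free_set_vars \<theta>'. E V \<le>\<^sub>T Z"
    using turing_ideal_finite_bound[OF S, of "free_set_vars \<theta> \<union> free_set_vars \<theta>'" E]
      finite_free_set_vars E by blast
  have matrix: "decidable {Z} (\<lambda>_ w. sat (omega S) (e(x := pfst w, v := psnd w)) E \<chi>)"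
    if "bounded_form \<chi>" "free_set_vars \<chi> \<subseteq> free_set_vars \<theta> \<union> free_set_vars \<theta>'" for v \<chi>
  proof -
    let ?env = "\<lambda>u (_::nat set) w. if u = v then psnd w else if u = x then pfst w else e u"
    have env: "(\<lambda>u. ?env u X w) = e(x := pfst w, v := psnd w)" for X w by auto
    have "computable {Z} (?env u)" for u
      by (cases "u = v"; cases "u = x") (simp_all, (intro computable_intros)+)
    moreover have "decidable {Z} (\<lambda>_ n. n \<in> E V)" if "V \<in> free_set_vars \<chi>" for V
      using Z(2) that \<open>free_set_vars \<chi> \<subseteq> _\<close> by (auto simp: turing_le_iff_decidable)
    ultimately show ?thesis
      using decidable_bounded_form[of \<chi> "{Z}" E ?env S] that(1) unfolding env by blast
  qed
  define P where "P a b \<longleftrightarrow> sat (omega S) (e(x := a, y := b)) E \<theta>" for a b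
  define Q where "Q a b \<longleftrightarrow> \<not> sat (omega S) (e(x := a, y' := b)) E \<theta>'" for a b
  have P: "decidable {Z} (\<lambda>_ w. P (pfst w) (psnd w))"
    unfolding P_def by (intro matrix \<theta>) auto
  have Q: "decidable {Z} (\<lambda>_ w. Q (pfst w) (psnd w))"
    unfolding Q_def by (intro decidable_not matrix \<theta>') auto
  have PQ: "(\<exists>b. P a b) \<longleftrightarrow> \<not> (\<exists>b. Q a b)" for a
    using eq[of a] unfolding \<theta> \<theta>' P_def Q_def by simp
  have ex: "\<exists>b. P a b \<or> Q a b" for a using PQ by blast
  have "computable {Z} (\<lambda>_ a. LEAST b. P a b \<or> Q a b)"
    by (rule computable_Least[where P = "\<lambda>_ a b. P a b \<or> Q a b"])
       (intro decidable_disj P Q, rule ex)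
  then have "decidable {Z} (\<lambda>_ a. P a (LEAST b. P a b \<or> Q a b))"
    using decidable_comp[OF P computable_pair[OF computable_id]] by simp
  moreover have "P a (LEAST b. P a b \<or> Q a b) \<longleftrightarrow> (\<exists>b. P a b)" for a
    using LeastI_ex[OF ex[of a]] PQ[of a] by blast
  ultimately have "{a. sat (omega S) (e(x := a)) E \<phi>} \<le>\<^sub>T Z"
    by (simp add: turing_le_iff_decidable \<theta>(1) P_def)
  then show ?thesis using S Z(1) unfolding turing_ideal_def by blast
qed

lemma turing_ideal_models_RCA0:
  assumes S: "turing_ideal S"
  shows "omega S \<Turnstile> RCA0"
  unfolding models_def RCA0_def
proof (intro conjI ballI allI impI)
  show "ssets (omega S) \<noteq> {}" using S by (simp add: turing_ideal_def)
  fix \<phi> and e :: "nat \<Rightarrow> nat" and E :: "nat \<Rightarrow> nat set"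
  assume \<phi>: "\<phi> \<in> discrete_ordered_semiring
     \<union> {induction_axiom x \<phi> | x \<phi>. \<phi> \<in> Sigma01}
     \<union> {AllN x (\<phi> \<^bold>\<longleftrightarrow> \<psi>) \<^bold>\<longrightarrow> comprehension x X \<phi> | x X \<phi> \<psi>.
          \<phi> \<in> Sigma01 \<and> \<psi> \<in> Pi01 \<and> X \<notin> free_set_vars \<phi>}"
    and E: "\<forall>X. E X \<in> ssets (omega S)"
  from \<phi> consider
      "\<phi> \<in> discrete_ordered_semiring"
    | x \<chi> where "\<phi> = induction_axiom x \<chi>"
    | x X \<chi> \<psi> where "\<phi> = (AllN x (\<chi> \<^bold>\<longleftrightarrow> \<psi>) \<^bold>\<longrightarrow> comprehension x X \<chi>)"
        "\<chi> \<in> Sigma01" "\<psi> \<in> Pi01" "X \<notin> free_set_vars \<chi>"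
    by blast
  then show "sat (omega S) e E \<phi>"
  proof cases
    case 1
    then show ?thesis
      unfolding discrete_ordered_semiring_def Let_def
      by (elim insertE emptyE; simp add: algebra_simps; presburger?)
  next
    case (2 x \<chi>)
    have "sat (omega S) (e(x := a)) E \<chi>"
      if "sat (omega S) (e(x := 0)) E \<chi>"
        "\<And>a. sat (omega S) (e(x := a)) E \<chi> \<Longrightarrow> sat (omega S) (e(x := Suc a)) E \<chi>" for a
      using that by (induction a) auto
    then show ?thesis by (simp add: 2 induction_axiom_def sat_subst)
  next
    case (3 x X \<chi> \<psi>)
    have *: "sat (omega S) f (E(X := A)) \<chi> \<longleftrightarrow> sat (omega S) f E \<chi>" for f A
      using 3(4) by (intro sat_set_cong) auto
    have "{a. sat (omega S) (e(x := a)) E \<chi>} \<in> S"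
      if "\<forall>a. sat (omega S) (e(x := a)) E \<chi> \<longleftrightarrow> sat (omega S) (e(x := a)) E \<psi>"
      using sat_delta_set_mem[OF S _ 3(2,3), of E e x] E that by simp
    then show ?thesis
      by (auto simp: 3(1) comprehension_def * intro!: bexI[of _ "{a. sat (omega S) (e(x := a)) E \<chi>}"])
  qed
qed

section \<open>The intersection principle in the ideal below a generic set\<close>

definition columns_upto :: "nat \<Rightarrow> nat set \<Rightarrow> nat set" where
  "columns_upto n X = {w \<in> X. pfst w \<le> n}"

definition column :: "nat \<Rightarrow> nat set \<Rightarrow> nat set" where
  "column n X = {t. prod_encode (n, t) \<in> X}"

lemma decidable_columns_upto: "decidable K (\<lambda>X w. w \<in> columns_upto n X)"
  unfolding columns_upto_def mem_Collect_eq by (intro computable_intros)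

lemma columns_upto_turing_le: "columns_upto n X \<le>\<^sub>T X"
  unfolding turing_le_iff_decidable
  by (rule decidable_cong[OF decidable_columns_upto[of _ n]]) simp

lemma columns_upto_mono: "m \<le> n \<Longrightarrow> columns_upto m X \<le>\<^sub>T columns_upto n X"
proof -
  assume "m \<le> n"
  then have "columns_upto m (columns_upto n X) = columns_upto m X"
    by (auto simp: columns_upto_def)
  then show ?thesis using columns_upto_turing_le by metis
qed

lemma decidable_member:
  assumes "decidable K (\<lambda>X n. n \<in> A)" "computable K i" "computable K x"
  shows "decidable K (\<lambda>X z. x X z \<in> member A (i X z))"
proof -
  have "computable K (\<lambda>X z. (i X z + x X z)\<^sup>2 + i X z)"
    by (intro computable_intros assms)
  from decidable_comp[OF assms(1) this] show ?thesis by (simp add: member_def)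
qed

text \<open>The square of \<open>i + x\<close> and the next square differ by more than \<open>i\<close>.\<close>

lemma square_pairing_inject:
  fixes i x j y :: nat
  assumes "(i + x)\<^sup>2 + i = (j + y)\<^sup>2 + j"
  shows "i = j \<and> x = y"
proof -
  have le: "a + b \<le> c + d" if "(a + b)\<^sup>2 + a = (c + d)\<^sup>2 + c" for a b c d :: nat
  proof (rule ccontr)
    assume "\<not> a + b \<le> c + d"
    then have "Suc (c + d) \<le> a + b" by simp
    then have "(Suc (c + d))\<^sup>2 \<le> (a + b)\<^sup>2" by (rule power_mono) simp
    then have "(c + d)\<^sup>2 + (2 * (c + d) + 1) \<le> (a + b)\<^sup>2" by (simp add: power2_eq_square)
    moreover have "False" if "Q + (2 * (c + d) + 1) \<le> P" "P + a = Q + c" for P Q :: nat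
      using that by presburger
    ultimately show False using that by blast
  qed
  have "i + x = j + y" using le[OF assms] le[OF assms[symmetric]] by simp
  with assms show ?thesis by simp
qed

text \<open>A number \<open>t\<close> is a proposal \<open>(j, (x, v))\<close> to add the \<open>j\<close>-th member of the family, with witness
  \<open>x\<close>. The component \<open>v\<close> is padding: the same proposal can be made by arbitrarily large numbers.\<close>

definition prop_index :: "nat \<Rightarrow> nat" where "prop_index t = pfst t"
definition prop_witness :: "nat \<Rightarrow> nat" where "prop_witness t = pfst (psnd t)"

text \<open>The witness of an accepted proposal lies in every member accepted so far. The member with index
  0 counts as accepted from the start.\<close>

fun accepted :: "nat set \<Rightarrow> nat set \<Rightarrow> nat \<Rightarrow> bool" where
  "accepted A H t \<longleftrightarrow> t \<in> H \<and> prop_witness t \<in> member A 0 \<and>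
     prop_witness t \<in> member A (prop_index t) \<and>
     (\<forall>i<t. accepted A H i \<longrightarrow> prop_witness t \<in> member A (prop_index i))"

declare accepted.simps [simp del]

text \<open>Row 0 of the chosen family is the initial member, and row \<open>t + 1\<close> is the member added by
  proposal \<open>t\<close>. A rejected proposal yields the initial member once more, since every row of a
  subfamily has to be a member of the family.\<close>

definition chosen_index :: "nat set \<Rightarrow> nat set \<Rightarrow> nat \<Rightarrow> nat" where
  "chosen_index A H i = (if 0 < i \<and> accepted A H (i - 1) then prop_index (i - 1) else 0)"

definition chosen :: "nat set \<Rightarrow> nat set \<Rightarrow> nat set" where
  "chosen A H = {w. \<exists>i x. w = (i + x)\<^sup>2 + i \<and> x \<in> member A (chosen_index A H i)}"

lemma member_chosen: "member (chosen A H) i = member A (chosen_index A H i)"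
proof (rule set_eqI)
  fix x
  have "x \<in> member (chosen A H) i \<longleftrightarrow>
      (\<exists>j y. (i + x)\<^sup>2 + i = (j + y)\<^sup>2 + j \<and> y \<in> member A (chosen_index A H j))"
    by (simp add: member_def[of "chosen A H"]) (simp add: chosen_def)
  also have "\<dots> \<longleftrightarrow> x \<in> member A (chosen_index A H i)"
    using square_pairing_inject[of i x] by blast
  finally show "x \<in> member (chosen A H) i \<longleftrightarrow> x \<in> member A (chosen_index A H i)" .
qed

lemma accepted_cong:
  assumes "\<And>i. i \<le> t \<Longrightarrow> i \<in> H \<longleftrightarrow> i \<in> H'"
  shows "accepted A H t \<longleftrightarrow> accepted A H' t"
  using assms
proof (induction t rule: less_induct)
  case (less t)
  then have "accepted A H i \<longleftrightarrow> accepted A H' i" if "i < t" for i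
    using that by simp
  then show ?case using less.prems by (simp add: accepted.simps[of A _ t])
qed

text \<open>The proposals accepted before \<open>t\<close> are coded as a finite set, so that the course-of-values
  recursion becomes a primitive recursion.\<close>

lemma decidable_accepted:
  assumes A: "decidable K (\<lambda>X n. n \<in> A)" and H: "decidable K (\<lambda>X t. t \<in> H X)"
    and t: "computable K t"
  shows "decidable K (\<lambda>X z. accepted A (H X) (t X z))"
proof -
  define good where "good X t r \<longleftrightarrow> t \<in> H X \<and> prop_witness t \<in> member A 0 \<and>
     prop_witness t \<in> member A (prop_index t) \<and>
     (\<forall>i<t. i \<in> set_decode r \<longrightarrow> prop_witness t \<in> member A (prop_index i))" for X t r
  define step where "step X t r = (if good X t r then r + 2 ^ t else r)" for X t r
  define hist where "hist X t = rec_nat 0 (step X) t" for X t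
  have "hist X t = set_encode {i. i < t \<and> accepted A (H X) i}" for X t
  proof (induction t)
    case 0
    then show ?case by (simp add: hist_def)
  next
    case (Suc t)
    let ?I = "{i. i < t \<and> accepted A (H X) i}"
    have fin: "finite ?I" by simp
    have "good X t (hist X t) \<longleftrightarrow> accepted A (H X) t"
      unfolding good_def Suc.IH accepted.simps[of A _ t] set_encode_inverse[OF fin] by blast
    then have "hist X (Suc t) = (if accepted A (H X) t then hist X t + 2 ^ t else hist X t)"
      by (simp add: hist_def step_def)
    also have "\<dots> = set_encode {i. i < Suc t \<and> accepted A (H X) i}"
    proof (cases "accepted A (H X) t")
      case True
      then have "{i. i < Suc t \<and> accepted A (H X) i} = insert t ?I" by (auto simp: less_Suc_eq)
      then show ?thesis using True Suc.IH by (simp add: set_encode_insert)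
    next
      case False
      then have "{i. i < Suc t \<and> accepted A (H X) i} = ?I" by (auto simp: less_Suc_eq)
      then show ?thesis using False Suc.IH by simp
    qed
    finally show ?case .
  qed
  then have hist: "accepted A (H X) t \<longleftrightarrow> t \<in> set_decode (hist X (Suc t))" for X t
    by (simp add: set_encode_inverse)
  have H': "decidable K (\<lambda>X w. f X w \<in> H X)" if "computable K f" for f
    by (rule decidable_comp[OF H that])
  have "computable K (\<lambda>X z. hist X z)"
    unfolding hist_def
  proof (rule computable_prec[where s = "\<lambda>X _. step X"])
    show "computable K (\<lambda>X w. step X (pfst (psnd w)) (psnd (psnd w)))"
      unfolding step_def good_def prop_witness_def prop_index_def
      by (intro computable_intros H' decidable_member[OF A])
  qed (intro computable_intros)+
  from computable_comp[OF this computable_Suc[OF t]]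
  show ?thesis unfolding hist by (intro computable_intros t)
qed

lemma decidable_chosen:
  assumes A: "decidable K (\<lambda>X n. n \<in> A)" and H: "decidable K (\<lambda>X t. t \<in> H X)"
  shows "decidable K (\<lambda>X w. w \<in> chosen A (H X))"
proof -
  have bound: "w \<in> chosen A H \<longleftrightarrow> (\<exists>i<Suc w. \<exists>x<Suc w. w = (i + x)\<^sup>2 + i
      \<and> x \<in> member A (chosen_index A H i))" for w H
  proof -
    have "i < Suc ((i + x)\<^sup>2 + i) \<and> x < Suc ((i + x)\<^sup>2 + i)" for i x :: nat
    proof -
      have "i + x \<le> (i + x)\<^sup>2" unfolding power2_eq_square by (rule le_square)
      then show ?thesis by linarith
    qed
    then show ?thesis unfolding chosen_def mem_Collect_eq by metis
  qed
  show ?thesis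
    unfolding bound chosen_index_def prop_index_def
    by (intro computable_intros decidable_member[OF A] decidable_accepted[OF A H])
qed

lemma subfamily_chosen: "subfamily (chosen A H) A"
  unfolding subfamily_def member_chosen by blast

text \<open>Among finitely many accepted proposals, the witness of the largest lies in all their members.\<close>

lemma chosen_common_point:
  assumes ne: "member A 0 \<noteq> {}" and "finite I"
  shows "\<exists>x. \<forall>i\<in>I. x \<in> member A (chosen_index A H i)"
proof (cases "\<exists>t. Suc t \<in> I \<and> accepted A H t")
  case False
  then have "chosen_index A H i = 0" if "i \<in> I" for i
    using that by (cases i) (auto simp: chosen_index_def)
  then show ?thesis using ne by fastforce
next
  case True
  define T where "T = {t. Suc t \<in> I \<and> accepted A H t}"
  have "finite T" unfolding T_def
    using finite_vimageI[OF \<open>finite I\<close>, of Suc] by (auto intro: finite_subset[rotated])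
  moreover have "T \<noteq> {}" using True by (simp add: T_def)
  ultimately have max: "Max T \<in> T" "\<And>t. t \<in> T \<Longrightarrow> t \<le> Max T" by auto
  then have acc: "accepted A H (Max T)" by (simp add: T_def)
  then have w: "prop_witness (Max T) \<in> member A 0"
    "prop_witness (Max T) \<in> member A (prop_index (Max T))"
    "\<And>t. t < Max T \<Longrightarrow> accepted A H t \<Longrightarrow> prop_witness (Max T) \<in> member A (prop_index t)"
    unfolding accepted.simps[of A H "Max T"] by blast+
  have "prop_witness (Max T) \<in> member A (chosen_index A H i)" if "i \<in> I" for i
  proof (cases "0 < i \<and> accepted A H (i - 1)")
    case True
    then have "i - 1 \<in> T" using that by (simp add: T_def)
    then have "i - 1 \<le> Max T" by (rule max(2))
    then show ?thesis
      using w(2) w(3)[of "i - 1"] True unfolding chosen_index_def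
      by (cases "i - 1 = Max T") simp_all
  next
    case False
    then show ?thesis using w(1) unfolding chosen_index_def by auto
  qed
  then show ?thesis by blast
qed

lemma F_intersection_chosen:
  assumes "member A 0 \<noteq> {}"
  shows "F_intersection (chosen A H)"
  unfolding F_intersection_def
proof (intro allI impI)
  fix m F assume "F \<subseteq> range (member (chosen A H))" "finite F \<and> card F = m"
  then obtain I where I: "finite I" "F = member (chosen A H) ` I"
    by (metis finite_subset_image)
  then show "\<Inter>F \<noteq> {}"
    using chosen_common_point[OF assms I(1), of H] by (auto simp: member_chosen)
qed

lemma prod_encode_less: "i < j \<Longrightarrow> prod_encode (n, i) < prod_encode (n, j)"
proof -
  have "triangle (n + i) \<le> triangle (n + i + d)" for d
    by (induction d) auto
  moreover assume "i < j"
  then have "n + j = Suc (n + i + (j - Suc i))" by simp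
  then have "triangle (n + j) = triangle (n + i + (j - Suc i)) + Suc (n + i + (j - Suc i))"
    by (simp only: triangle_Suc)
  ultimately show ?thesis unfolding prod_encode_def prod.case
    by (metis add.commute add_less_cancel_left le_imp_less_Suc less_add_Suc1 order_le_less_trans
        add_Suc_right)
qed

text \<open>Suppose that the \<open>j\<close>-th member of \<open>A\<close> occurs in \<open>C\<close> but was not chosen. The program that waits
  for the acceptance of a proposal for \<open>j\<close> does not halt relative to \<open>generic\<close>, so some bound \<open>u\<close>
  exists such that it halts for no oracle agreeing with \<open>generic\<close> below \<open>u\<close>. The contradiction
  comes from an oracle \<open>X\<close> of this kind that keeps the columns up to \<open>n\<close>, from which the program
  computes \<open>A\<close>, and whose only element from \<open>u\<close> on in column \<open>n + 1\<close> is an acceptable proposal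
  for \<open>j\<close>. Its witness is provided by the intersection property of \<open>C\<close>.\<close>

lemma subfamily_of_chosen:
  assumes A: "A \<le>\<^sub>T columns_upto n generic"
    and ne: "\<And>i. member A i \<noteq> {}"
    and C: "subfamily C A" "F_intersection C" "subfamily (chosen A (column (Suc n) generic)) C"
  shows "subfamily C (chosen A (column (Suc n) generic))"
proof -
  let ?H = "column (Suc n)"
  let ?B = "chosen A (?H generic)"
  let ?K = "{X. columns_upto n X = columns_upto n generic}"
  (* All oracles in ?K have the columns that compute A, so one program computes A from them. *)
  have AK: "decidable ?K (\<lambda>_ n. n \<in> A)"
  proof (rule decidable_subst[where Y = "columns_upto n generic" and P = "\<lambda>_ n. n \<in> A"])
    show "decidable {columns_upto n generic} (\<lambda>_ n. n \<in> A)"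
      using A by (simp add: turing_le_iff_decidable)
    show "decidable ?K (\<lambda>X w. w \<in> columns_upto n generic)"
      by (rule decidable_cong[OF decidable_columns_upto[of _ n]]) simp
  qed
  have HK: "decidable ?K (\<lambda>X t. t \<in> ?H X)"
    unfolding column_def mem_Collect_eq by (intro computable_intros)
  have sub: "member A j \<in> range (member ?B)" if j: "member C k = member A j" for k j
  proof (rule ccontr)
    assume notin: "member A j \<notin> range (member ?B)"
    have in_B: "member A 0 \<in> range (member ?B)"
      "accepted A (?H generic) t \<Longrightarrow> member A (prop_index t) \<in> range (member ?B)" for t
      unfolding member_chosen using rangeI[of "\<lambda>i. member A (chosen_index A (?H generic) i)" 0]
        rangeI[of "\<lambda>i. member A (chosen_index A (?H generic) i)" "Suc t"]
      by (auto simp: chosen_index_def)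
    have dec: "decidable ?K (\<lambda>X w. accepted A (?H X) (psnd w) \<and> prop_index (psnd w) = j)"
      unfolding prop_index_def by (intro computable_intros decidable_accepted[OF AK HK])
    obtain f where "\<forall>L. computable L (\<lambda>_. f)" and f:
      "\<forall>X\<in>?K. \<forall>z. f z \<in> jump X \<longleftrightarrow> (\<exists>t. accepted A (?H X) t \<and> prop_index t = j)"
      using ce_index[of ?K "\<lambda>X _ t. accepted A (?H X) t \<and> prop_index t = j", OF dec]
      by (elim exE conjE)
    have "f 0 \<notin> jump generic" using f in_B(2) notin by auto
    then obtain u where u: "\<And>H. (\<And>n. n < u \<Longrightarrow> n \<in> H \<longleftrightarrow> n \<in> generic) \<Longrightarrow> f 0 \<notin> jump H"
      by (rule generic_decides) blast
    (* T: the proposals accepted within the part of generic below u. *)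
    define T where "T = {t. accepted A (?H generic) t \<and> prod_encode (Suc n, t) < u}"
    have "finite T"
    proof (rule finite_subset)
      show "T \<subseteq> {..<u}"
        unfolding T_def using le_prod_encode_2[of _ "Suc n"] by (auto intro: le_less_trans)
    qed simp
    define Fm where "Fm = insert (member A j) (insert (member A 0) ((\<lambda>t. member A (prop_index t)) ` T))"
    have "range (member ?B) \<subseteq> range (member C)" using C(3) by (force simp: subfamily_def)
    then have "Fm \<subseteq> range (member C)"
      unfolding Fm_def T_def using j in_B by (auto simp flip: j)
    moreover have fin: "finite Fm" using \<open>finite T\<close> by (simp add: Fm_def)
    moreover have "2 \<le> card Fm"
    proof -
      have "card {member A j, member A 0} \<le> card Fm"
        by (rule card_mono[OF fin]) (simp add: Fm_def)
      moreover have "member A j \<noteq> member A 0" using notin in_B(1) by metis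
      ultimately show ?thesis by simp
    qed
    ultimately obtain x where x: "x \<in> \<Inter>Fm" using C(2) unfolding F_intersection_def by blast
    (* The padding u puts the new proposal beyond the part of generic that must be kept. *)
    define t where "t = prod_encode (j, prod_encode (x, u))"
    have t: "prop_index t = j" "prop_witness t = x" by (simp_all add: t_def prop_index_def prop_witness_def)
    have "u \<le> t" unfolding t_def using le_prod_encode_2 le_trans by blast
    then have tu: "u \<le> prod_encode (Suc n, t)" using le_prod_encode_2 le_trans by blast
    define X where "X = columns_upto n generic \<union> (generic \<inter> {..<u}) \<union> {prod_encode (Suc n, t)}"
    have XK: "X \<in> ?K" unfolding X_def columns_upto_def by auto
    have Xu: "w \<in> X \<longleftrightarrow> w \<in> generic" if "w < u" for w
      using that tu unfolding X_def columns_upto_def by auto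
    have "accepted A (?H X) t"
      unfolding accepted.simps[of _ _ t] t
    proof (intro conjI allI impI)
      show "t \<in> ?H X" by (simp add: column_def X_def)
      show "x \<in> member A 0" "x \<in> member A j" using x by (auto simp: Fm_def)
      fix i assume i: "i < t" "accepted A (?H X) i"
      then have "prod_encode (Suc n, i) \<in> X" by (simp add: accepted.simps[of _ _ i] column_def)
      then have iu: "prod_encode (Suc n, i) < u"
        using i(1) by (auto simp: X_def columns_upto_def)
      have "accepted A (?H X) i \<longleftrightarrow> accepted A (?H generic) i"
      proof (rule accepted_cong)
        fix i' assume "i' \<le> i"
        then have "prod_encode (Suc n, i') \<le> prod_encode (Suc n, i)"
          using prod_encode_less[of i' i "Suc n"] by (cases "i' = i") auto
        then show "i' \<in> ?H X \<longleftrightarrow> i' \<in> ?H generic" using Xu iu by (simp add: column_def)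
      qed
      with i(2) iu have "i \<in> T" by (simp add: T_def)
      then show "x \<in> member A (prop_index i)" using x by (auto simp: Fm_def)
    qed
    then have "f 0 \<in> jump X" using f XK t(1) by blast
    with u Xu show False by blast
  qed
  show ?thesis unfolding subfamily_def
  proof
    fix k
    obtain j where "member C k = member A j" using C(1) unfolding subfamily_def by blast
    from this sub[OF this] show "\<exists>l. member C k = member ?B l" by auto
  qed
qed

definition generic_ideal :: "nat set set" where
  "generic_ideal = {Y. \<exists>n. Y \<le>\<^sub>T columns_upto n generic}"

text \<open>A family with the intersection property that contains the empty set contains nothing else. The
  set \<open>{}\<close> codes the family all of whose rows are empty.\<close>

lemma empty_subfamily_maximal:
  assumes "member A i = {}"
  shows "subfamily {} A" "F_intersection {}"
    and "subfamily C A \<Longrightarrow> F_intersection C \<Longrightarrow> subfamily {} C \<Longrightarrow> subfamily C {}"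
proof -
  have empty: "member {} k = {}" for k by (simp add: member_def)
  show "subfamily {} A" using assms by (auto simp: subfamily_def empty)
  show "F_intersection {}"
    unfolding F_intersection_def
  proof (intro allI impI)
    fix m :: nat and F assume "2 \<le> m" "F \<subseteq> range (member {})" "finite F \<and> card F = m"
    moreover have "card (range (member {})) = 1" by (simp add: empty)
    moreover have "finite (range (member {}))" by (simp add: empty)
    ultimately show "\<Inter>F \<noteq> {}" using card_mono[of "range (member {})" F] by simp
  qed
  assume C: "F_intersection C" "subfamily {} C"
  then obtain l where l: "member C l = {}" unfolding subfamily_def empty by metis
  have "member C k = {}" for k
  proof (rule ccontr)
    assume "member C k \<noteq> {}"
    then have "card {member C l, member C k} = 2" using l by simp
    then have "\<Inter>{member C l, member C k} \<noteq> {}"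
      using C(1)[unfolded F_intersection_def, rule_format, of 2 "{member C l, member C k}"] by simp
    then show False using l by simp
  qed
  then show "subfamily C {}" by (simp add: subfamily_def empty)
qed

lemma generic_ideal_models_FIP: "omega generic_ideal \<Turnstile> {FIP}"
  unfolding omega_models_FIP
proof (intro conjI ballI impI)
  have empty: "{} \<le>\<^sub>T X" for X by (simp add: turing_le_iff_decidable decidable_const)
  then have empty_mem: "{} \<in> generic_ideal" by (auto simp: generic_ideal_def)
  then show "generic_ideal \<noteq> {}" by blast
  fix A assume "A \<in> generic_ideal" "nontrivial A"
  then obtain n where A: "A \<le>\<^sub>T columns_upto n generic" by (auto simp: generic_ideal_def)
  show "\<exists>B\<in>generic_ideal. subfamily B A \<and> F_intersection B \<and>
    (\<forall>C\<in>generic_ideal. subfamily C A \<and> F_intersection C \<and> subfamily B C \<longrightarrow> subfamily C B)"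
  proof (cases "\<exists>i. member A i = {}")
    case True
    then show ?thesis using empty_subfamily_maximal empty_mem by (intro bexI[of _ "{}"]) blast+
  next
    case False
    let ?B = "chosen A (column (Suc n) generic)"
    let ?Z = "columns_upto (Suc n) generic"
    have "column (Suc n) ?Z = column (Suc n) generic"
      by (auto simp: column_def columns_upto_def)
    moreover have "decidable {?Z} (\<lambda>X w. w \<in> chosen A (column (Suc n) X))"
    proof (rule decidable_chosen)
      show "decidable {?Z} (\<lambda>_ n. n \<in> A)"
        using turing_le_trans[OF A columns_upto_mono[of n "Suc n"]]
        by (simp add: turing_le_iff_decidable)
      show "decidable {?Z} (\<lambda>X t. t \<in> column (Suc n) X)"
        unfolding column_def mem_Collect_eq by (intro computable_intros)
    qed
    ultimately have "?B \<le>\<^sub>T ?Z"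
      unfolding turing_le_iff_decidable by (auto elim: decidable_cong)
    then have "?B \<in> generic_ideal" by (auto simp: generic_ideal_def)
    then show ?thesis
      using False subfamily_chosen F_intersection_chosen subfamily_of_chosen[OF A]
      by (intro bexI[of _ ?B]) blast+
  qed
qed

section \<open>Arithmetical definability of the halting problem\<close>

text \<open>Arithmetical definability without set parameters, as a property of relations on assignments of
  the number variables; the relation must be the same in all \<open>\<omega>\<close>-models.\<close>

definition definable :: "((nat \<Rightarrow> nat) \<Rightarrow> bool) \<Rightarrow> bool" where
  "definable P \<longleftrightarrow> (\<exists>\<phi>. arithmetical \<phi> \<and> free_set_vars \<phi> = {} \<and>
     (\<forall>S e E. sat (omega S) e E \<phi> \<longleftrightarrow> P e))"

lemma definableI:
  assumes "arithmetical \<phi>" "free_set_vars \<phi> = {}" "\<And>S e E. sat (omega S) e E \<phi> \<longleftrightarrow> P e"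
  shows "definable P"
  using assms unfolding definable_def by blast

lemma definable_not: "definable P \<Longrightarrow> definable (\<lambda>e. \<not> P e)"
  unfolding definable_def
  by (elim exE, rule_tac x = "\<^bold>\<not> \<phi>" in exI) simp

lemma definable_conj: "definable P \<Longrightarrow> definable Q \<Longrightarrow> definable (\<lambda>e. P e \<and> Q e)"
  unfolding definable_def
  by (elim exE, rule_tac x = "\<phi> \<^bold>\<and> \<phi>'" in exI) simp

lemma definable_imp: "definable P \<Longrightarrow> definable Q \<Longrightarrow> definable (\<lambda>e. P e \<longrightarrow> Q e)"
  unfolding definable_def
  by (elim exE, rule_tac x = "\<phi> \<^bold>\<longrightarrow> \<phi>'" in exI) simp

lemma definable_ex: "definable P \<Longrightarrow> definable (\<lambda>e. \<exists>a. P (e(x := a)))"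
  unfolding definable_def
  by (elim exE, rule_tac x = "ExN x \<phi>" in exI) simp

lemma definable_all: "definable P \<Longrightarrow> definable (\<lambda>e. \<forall>a. P (e(x := a)))"
  unfolding definable_def
  by (elim exE, rule_tac x = "AllN x \<phi>" in exI) simp

lemma definable_eq: "definable (\<lambda>e. e x = e y)"
  by (rule definableI[of "Var x \<^bold>= Var y"]) simp_all

lemma definable_less: "definable (\<lambda>e. e x < e y)"
  by (rule definableI[of "Var x \<^bold>< Var y"]) simp_all

lemma definable_zero: "definable (\<lambda>e. e x = 0)"
  by (rule definableI[of "Var x \<^bold>= Zero"]) simp_all

lemma definable_Suc: "definable (\<lambda>e. e y = Suc (e x))"
  by (rule definableI[of "Var y \<^bold>= Var x \<^bold>+ One"]) simp_all

lemma prod_encode_eq_iff: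
  "w = prod_encode (a, b) \<longleftrightarrow> w + w = (a + b) * (a + b + 1) + (a + a)"
proof -
  have "2 * triangle n = n * (n + 1)" for n by (induction n) auto
  from this[of "a + b"] show ?thesis unfolding prod_encode_def prod.case by linarith
qed

lemma definable_pair: "definable (\<lambda>e. e w = prod_encode (e a, e b))"
  by (rule definableI[of "Var w \<^bold>+ Var w \<^bold>=
        (Var a \<^bold>+ Var b) \<^bold>* (Var a \<^bold>+ Var b \<^bold>+ One) \<^bold>+ (Var a \<^bold>+ Var a)"])
     (simp_all add: prod_encode_eq_iff)

lemma definable_beta:
  assumes "0 < a" "0 < b" "0 < i" "0 < u"
  shows "definable (\<lambda>e. e u = e a mod Suc (Suc (e i) * e b))"
  by (rule definableI[of "beta_form (Var a) (Var b) (Var i) (Var u)"])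
     (use assms in \<open>simp_all add: beta_form_def Let_def flip: beta_mod\<close>)

lemmas definable_intros =
  definable_not definable_conj definable_imp definable_eq definable_less definable_zero
  definable_Suc definable_pair definable_beta

text \<open>Primitive recursion is rewritten with the sequence of its intermediate values. Formulas can
  quantify over such sequences by means of the beta function.\<close>

lemma computes_PPrec_iff:
  "computes X (PPrec p q) (prod_encode (a, k)) m \<longleftrightarrow>
    (\<exists>s. computes X p a (s 0) \<and>
      (\<forall>i<k. computes X q (prod_encode (a, prod_encode (i, s i))) (s (Suc i))) \<and> s k = m)"
  (is "?L k m \<longleftrightarrow> ?R k m")
proof
  show "?L k m \<Longrightarrow> ?R k m"
  proof (induction k arbitrary: m)
    case 0
    then have "computes X p a m" by cases auto
    then show ?case by (intro exI[of _ "\<lambda>_. m"]) simp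
  next
    case (Suc k)
    from Suc.prems obtain r where r: "?L k r"
      "computes X q (prod_encode (a, prod_encode (k, r))) m"
      by cases auto
    from Suc.IH[OF r(1)] obtain s where "computes X p a (s 0)"
      "\<forall>i<k. computes X q (prod_encode (a, prod_encode (i, s i))) (s (Suc i))" "s k = r" by blast
    with r(2) show ?case by (intro exI[of _ "s(Suc k := m)"]) (auto simp: less_Suc_eq)
  qed
next
  assume "?R k m"
  then obtain s where s: "computes X p a (s 0)"
    "\<forall>i<k. computes X q (prod_encode (a, prod_encode (i, s i))) (s (Suc i))" "s k = m" by blast
  have "?L i (s i)" if "i \<le> k" for i
    using that by (induction i) (use s in \<open>auto intro: computes.intros\<close>)
  with s(3) show "?L k m" by blast
qed

lemma computes_PMu_iff:
  "computes X (PMu p) n m \<longleftrightarrow> computes X p (prod_encode (n, m)) 0 \<and>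
    (\<forall>j<m. \<exists>r. computes X p (prod_encode (n, j)) (Suc r))"
  by (auto intro: computes.intros elim: computes.cases)

text \<open>Since the claim is made for every choice of the variables \<open>x\<close> and \<open>y\<close>, the induction hypotheses
  can be used with fresh variables for intermediate values, which takes the place of substitution
  into formulas. The variable 0 is excluded because the formula for the beta function binds it.\<close>

lemma definable_computes:
  assumes "0 < x" "0 < y" "x \<noteq> y"
  shows "definable (\<lambda>e. computes {} p (e x) (e y))"
  using assms
proof (induction p arbitrary: x y)
  case PZero
  have "computes {} PZero n m \<longleftrightarrow> m = 0" for n m by (auto intro: computes.intros elim: computes.cases)
  then show ?case by (simp add: definable_zero)
next
  case PSucc
  have "computes {} PSucc n m \<longleftrightarrow> m = Suc n" for n m by (auto intro: computes.intros elim: computes.cases)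
  then show ?case by (simp add: definable_Suc)
next
  case PLeft
  define b where "b = x + y"
  have "computes {} PLeft n m \<longleftrightarrow> (\<exists>b. n = prod_encode (m, b))" for n m
    by (auto intro: computes.intros elim: computes.cases)
  moreover have "definable (\<lambda>e. \<exists>a. (e(b := a)) x = prod_encode ((e(b := a)) y, (e(b := a)) b))"
    by (intro definable_ex definable_intros)
  ultimately show ?case using PLeft by (simp add: b_def)
next
  case PRight
  define b where "b = x + y"
  have "computes {} PRight n m \<longleftrightarrow> (\<exists>b. n = prod_encode (b, m))" for n m
    by (auto intro: computes.intros elim: computes.cases)
  moreover have "definable (\<lambda>e. \<exists>a. (e(b := a)) x = prod_encode ((e(b := a)) b, (e(b := a)) y))"
    by (intro definable_ex definable_intros)
  ultimately show ?case using PRight by (simp add: b_def)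
next
  case POracle
  have "computes {} POracle n m \<longleftrightarrow> m = 0" for n m
    using computes.intros(5)[of "{}" n] by (auto elim: computes.cases)
  then show ?case by (simp add: definable_zero)
next
  case (PPair p q)
  define a where "a = Suc (x + y)"
  define b where "b = Suc a"
  have v: "x < a" "y < a" "a < b" by (simp_all add: a_def b_def)
  have "computes {} (PPair p q) n m \<longleftrightarrow>
      (\<exists>a b. computes {} p n a \<and> computes {} q n b \<and> m = prod_encode (a, b))" for n m
    by (auto intro: computes.intros elim: computes.cases)
  moreover have "definable (\<lambda>e. computes {} p (e x) (e a) \<and> computes {} q (e x) (e b)
      \<and> e y = prod_encode (e a, e b))"
    using v PPair.prems by (intro definable_intros PPair.IH) auto
  from definable_ex[OF definable_ex[OF this, of b], of a]
  have "definable (\<lambda>e. \<exists>u w. computes {} p (e x) u \<and> computes {} q (e x) w \<and> e y = prod_encode (u, w))"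
    using v by simp
  ultimately show ?case by simp
next
  case (PComp p q)
  define a where "a = Suc (x + y)"
  have v: "x < a" "y < a" by (simp_all add: a_def)
  have "computes {} (PComp p q) n m \<longleftrightarrow> (\<exists>a. computes {} q n a \<and> computes {} p a m)" for n m
    by (auto intro: computes.intros elim: computes.cases)
  moreover have "definable (\<lambda>e. computes {} q (e x) (e a) \<and> computes {} p (e a) (e y))"
    using v PComp.prems by (intro definable_intros PComp.IH) auto
  from definable_ex[OF this, of a]
  have "definable (\<lambda>e. \<exists>u. computes {} q (e x) u \<and> computes {} p u (e y))"
    using v by simp
  ultimately show ?case by simp
next
  case (PMu p)
  define j where "j = Suc (x + y)"
  define w where "w = Suc j"
  define r where "r = Suc w"
  define r' where "r' = Suc r"
  have v: "x < j" "y < j" "j < w" "w < r" "r < r'" by (simp_all add: j_def w_def r_def r'_def)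
  have zero: "definable (\<lambda>e. e w = prod_encode (e x, e y) \<and> e r = 0 \<and> computes {} p (e w) (e r))"
    using v PMu.prems by (intro definable_intros PMu.IH) auto
  from definable_ex[OF definable_ex[OF this, of r], of w]
  have zero: "definable (\<lambda>e. computes {} p (prod_encode (e x, e y)) 0)"
    using v by simp
  have "definable (\<lambda>e. e w = prod_encode (e x, e j) \<and> e r' = Suc (e r) \<and> computes {} p (e w) (e r'))"
    using v PMu.prems by (intro definable_intros PMu.IH) auto
  from definable_ex[OF definable_ex[OF definable_ex[OF this, of r'], of r], of w]
  have "definable (\<lambda>e. \<exists>u. computes {} p (prod_encode (e x, e j)) (Suc u))"
    using v by simp
  then have "definable (\<lambda>e. e j < e y \<longrightarrow> (\<exists>u. computes {} p (prod_encode (e x, e j)) (Suc u)))"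
    by (intro definable_intros)
  from definable_conj[OF zero definable_all[OF this, of j]] show ?case
    using v by (simp add: computes_PMu_iff)
next
  case (PPrec p q)
  define a where "a = Suc (x + y)"
  define k where "k = Suc a"
  define c where "c = Suc k"
  define d where "d = Suc c"
  define i where "i = Suc d"
  define i' where "i' = Suc i"
  define r where "r = Suc i'"
  define r' where "r' = Suc r"
  define w where "w = Suc r'"
  define w' where "w' = Suc w"
  note defs = a_def k_def c_def d_def i_def i'_def r_def r'_def w_def w'_def
  have v: "x < a" "y < a" "a < k" "k < c" "c < d" "d < i" "i < i'" "i' < r" "r < r'" "r' < w" "w < w'"
    by (simp_all add: defs)
  let ?\<beta> = "\<lambda>c d i. c mod Suc (Suc i * d) :: nat"
  have "definable (\<lambda>e. e i = 0 \<and> e r = ?\<beta> (e c) (e d) (e i) \<and> computes {} p (e a) (e r))"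
    using v PPrec.prems by (intro definable_intros PPrec.IH) auto
  from definable_ex[OF definable_ex[OF this, of r], of i]
  have start: "definable (\<lambda>e. computes {} p (e a) (?\<beta> (e c) (e d) 0))"
    using v by simp
  have "definable (\<lambda>e. e i' = Suc (e i) \<and> e r = ?\<beta> (e c) (e d) (e i) \<and>
      e r' = ?\<beta> (e c) (e d) (e i') \<and> e w = prod_encode (e i, e r) \<and>
      e w' = prod_encode (e a, e w) \<and> computes {} q (e w') (e r'))"
    using v PPrec.prems by (intro definable_intros PPrec.IH) auto
  from definable_ex[OF definable_ex[OF definable_ex[OF definable_ex[OF definable_ex[OF this,
    of w'], of w], of r'], of r], of i']
  have "definable (\<lambda>e. computes {} q (prod_encode (e a, prod_encode (e i, ?\<beta> (e c) (e d) (e i))))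
      (?\<beta> (e c) (e d) (Suc (e i))))"
    using v by simp
  then have "definable (\<lambda>e. e i < e k \<longrightarrow>
      computes {} q (prod_encode (e a, prod_encode (e i, ?\<beta> (e c) (e d) (e i))))
      (?\<beta> (e c) (e d) (Suc (e i))))"
    by (intro definable_intros)
  from definable_all[OF this, of i] have steps: "definable (\<lambda>e. \<forall>i<e k.
      computes {} q (prod_encode (e a, prod_encode (i, ?\<beta> (e c) (e d) i))) (?\<beta> (e c) (e d) (Suc i)))"
    using v by simp
  have "definable (\<lambda>e. e x = prod_encode (e a, e k) \<and>
      (computes {} p (e a) (?\<beta> (e c) (e d) 0) \<and>
      (\<forall>i<e k. computes {} q (prod_encode (e a, prod_encode (i, ?\<beta> (e c) (e d) i)))
        (?\<beta> (e c) (e d) (Suc i))) \<and> e y = ?\<beta> (e c) (e d) (e k)))"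
    using v PPrec.prems by (intro definable_conj start steps definable_pair definable_beta) auto
  from definable_ex[OF definable_ex[OF definable_ex[OF definable_ex[OF this, of d], of c], of k], of a]
  have "definable (\<lambda>e. \<exists>a k. e x = prod_encode (a, k) \<and> (\<exists>c d. computes {} p a (?\<beta> c d 0) \<and>
      (\<forall>i<k. computes {} q (prod_encode (a, prod_encode (i, ?\<beta> c d i))) (?\<beta> c d (Suc i))) \<and>
      e y = ?\<beta> c d k))"
    using v by simp
  moreover have "computes {} (PPrec p q) n m \<longleftrightarrow>
     (\<exists>a k. n = prod_encode (a, k) \<and> (\<exists>c d. computes {} p a (?\<beta> c d 0) \<and>
      (\<forall>i<k. computes {} q (prod_encode (a, prod_encode (i, ?\<beta> c d i))) (?\<beta> c d (Suc i))) \<and>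
      m = ?\<beta> c d k))" (is "_ \<longleftrightarrow> ?R") for n m
  proof
    assume L: "computes {} (PPrec p q) n m"
    obtain a k where n: "n = prod_encode (a, k)" by (metis prod_encode_pfst_psnd)
    then obtain s where s: "computes {} p a (s 0)"
      "\<forall>i<k. computes {} q (prod_encode (a, prod_encode (i, s i))) (s (Suc i))" "s k = m"
      using L by (auto simp: computes_PPrec_iff)
    obtain c d where cd: "\<forall>i<Suc k. ?\<beta> c d i = s i" using beta_complete by blast
    have "computes {} p a (?\<beta> c d 0)" using cd s(1) by (metis zero_less_Suc)
    moreover have "computes {} q (prod_encode (a, prod_encode (i, ?\<beta> c d i))) (?\<beta> c d (Suc i))"
      if "i < k" for i using cd s(2) that by (metis Suc_mono less_SucI)
    moreover have "m = ?\<beta> c d k" using cd s(3) by (metis lessI)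
    ultimately show ?R using n by blast
  next
    assume ?R
    then obtain a k c d where n: "n = prod_encode (a, k)" and "computes {} p a (?\<beta> c d 0)"
      "\<forall>i<k. computes {} q (prod_encode (a, prod_encode (i, ?\<beta> c d i))) (?\<beta> c d (Suc i))"
      "m = ?\<beta> c d k" by blast
    then show "computes {} (PPrec p q) n m"
      unfolding n computes_PPrec_iff by (intro exI[of _ "?\<beta> c d"]) blast
  qed
  ultimately show ?case by simp
qed

lemma definable_jump: "definable (\<lambda>e. e 1 \<in> jump {})"
proof -
  have "decidable {{}} (\<lambda>X w. halting_by X (pfst w) (psnd w))"
    by (rule decidable_halting_by_oracle)
  then obtain p where p: "\<And>w. computes {} p w (of_bool (halting_by {} (pfst w) (psnd w)))"
    unfolding decidable_def computable_def by blast
  have "halting_by {} n d \<longleftrightarrow> computes {} p (prod_encode (n, d)) (Suc 0)" for n d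
    using p[of "prod_encode (n, d)"] computes_deterministic[OF p[of "prod_encode (n, d)"], of "Suc 0"]
    by (auto split: if_splits simp: of_bool_def)
  then have jump: "n \<in> jump {} \<longleftrightarrow> (\<exists>d. computes {} p (prod_encode (n, d)) (Suc 0))" for n
    by (simp add: mem_jump_iff)
  have "definable (\<lambda>e. e 3 = prod_encode (e 1, e 2) \<and> e 4 = 0 \<and> e 5 = Suc (e 4)
      \<and> computes {} p (e 3) (e 5))"
    by (intro definable_intros definable_computes) auto
  from definable_ex[OF definable_ex[OF definable_ex[OF definable_ex[OF this, of 5], of 4], of 3], of 2]
  have "definable (\<lambda>e. \<exists>d. computes {} p (prod_encode (e 1, d)) (Suc 0))"
    by simp
  then show ?thesis by (simp add: jump)
qed

lemma models_ACA0_jump: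
  assumes "omega S \<Turnstile> ACA0"
  shows "jump {} \<in> S"
proof -
  obtain \<phi> where \<phi>: "arithmetical \<phi>" "free_set_vars \<phi> = {}"
    "\<And>S e E. sat (omega S) e E \<phi> \<longleftrightarrow> e 1 \<in> jump {}"
    using definable_jump unfolding definable_def by blast
  have "comprehension 1 0 \<phi> \<in> ACA0" using \<phi>(1,2) unfolding ACA0_def by blast
  moreover obtain A where A: "A \<in> S" using assms by (auto simp: models_def)
  ultimately have "sat (omega S) (\<lambda>_. 0) (\<lambda>_. A) (comprehension 1 0 \<phi>)"
    using assms by (simp add: models_def)
  then obtain B where "B \<in> S" "\<forall>a. a \<in> B \<longleftrightarrow> a \<in> jump {}"
    by (auto simp: comprehension_def \<phi>(3))
  then show ?thesis by (metis set_eqI)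
qed

section \<open>The model of low sets\<close>

lemma turing_ideal_generic_ideal: "turing_ideal generic_ideal"
  unfolding turing_ideal_def
proof (intro conjI ballI allI impI)
  show "generic_ideal \<noteq> {}"
    using columns_upto_mono[OF order_refl] by (auto simp: generic_ideal_def)
next
  fix X Y assume "X \<in> generic_ideal" "Y \<le>\<^sub>T X"
  then show "Y \<in> generic_ideal" unfolding generic_ideal_def using turing_le_trans by blast
next
  fix X Y assume "X \<in> generic_ideal" "Y \<in> generic_ideal"
  then obtain m n where "X \<le>\<^sub>T columns_upto m generic" "Y \<le>\<^sub>T columns_upto n generic"
    by (auto simp: generic_ideal_def)
  then have "X \<le>\<^sub>T columns_upto (max m n) generic" "Y \<le>\<^sub>T columns_upto (max m n) generic"
    using turing_le_trans columns_upto_mono max.cobounded1 max.cobounded2 by metis+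
  moreover have "columns_upto (max m n) generic \<in> generic_ideal"
    using columns_upto_mono[OF order_refl] by (auto simp: generic_ideal_def)
  ultimately show "\<exists>Z\<in>generic_ideal. X \<le>\<^sub>T Z \<and> Y \<le>\<^sub>T Z" by blast
qed

lemma generic_ideal_low: "X \<in> generic_ideal \<Longrightarrow> low X"
  unfolding generic_ideal_def
  using low_mono[OF low_generic] turing_le_trans columns_upto_turing_le by blast

theorem proposition3p10:
  shows "(\<exists>S. omega S \<Turnstile> RCA0 \<union> {FIP} \<and> (\<forall>X\<in>S. low X)) \<and> \<not> implies_over RCA0 {FIP} ACA0"
proof -
  have model: "omega generic_ideal \<Turnstile> RCA0 \<union> {FIP}"
    using turing_ideal_models_RCA0[OF turing_ideal_generic_ideal] generic_ideal_models_FIP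
    unfolding models_def by blast
  have "\<not> low (jump {})" unfolding low_def by (rule jump_not_turing_le)
  then have "\<not> omega generic_ideal \<Turnstile> ACA0"
    using models_ACA0_jump generic_ideal_low by blast
  with model have "\<not> implies_over RCA0 {FIP} ACA0" unfolding implies_over_def by blast
  with model generic_ideal_low show ?thesis by blast
qed

end
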